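(* Let $n\geq 1$. Then $\operatorname{sdepth}(I(\mathcal{P}_{n,2}))> \operatorname{sdepth}(S_{n,2}/I(\mathcal{P}_{n,2}))=\left\lceil\frac{n}{3}\right\rceil$.
   Context: $K$ is a field. For a finite simple graph $G$ whose vertices are the variables of a polynomial ring over $K$, the edge ideal $I(G)$ is the squarefree monomial ideal generated by all products $uv$ with $\{u,v\}\in E(G)$. $P_n$ is the path on $n$ vertices ($P_1$ is a single vertex with no edges). The strong product $G_1\boxtimes G_2$ has vertex set $V(G_1)\times V(G_2)$, and two distinct vertices $(v_1,u_1),(v_2,u_2)$ are adjacent iff each coordinate pair is equal or adjacent ($v_1=v_2$ or $v_1v_2\in E(G_1)$, and $u_1=u_2$ or $u_1u_2\in E(G_2)$). Put $\mathcal{P}_{n,m}:=P_n\boxtimes P_m$, with vertices labelled by variables $x_{ij}$ ($1\le i\le n$, $1\le j\le m$), so that distinct $x_{ij},x_{kl}$ are adjacent iff $|i-k|\le 1$ and $|j-l|\le 1$. $S_{n,m}:=K[x_{ij}:1\le i\le n,\ 1\le j\le m]$; $I(\mathcal{P}_{n,m})$ is an ideal of $S_{n,m}$. Stanley depth: let $S=K[x_1,\dots,x_N]$ and $M$ a finitely generated $\mathbb{Z}^N$-graded $S$-module. A Stanley decomposition $\mathcal{D}$ of $M$ is a finite direct sum of $K$-vector spaces $M=\bigoplus_{i=1}^r w_iK[A_i]$ with $w_i\in M$ homogeneous, $A_i\subseteq\{x_1,\dots,x_N\}$, where $w_iK[A_i]$ (the $K$-span of all $w_iu$, $u$ a monomial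 in $K[A_i]$) is a free $K[A_i]$-module. $\operatorname{sdepth}(\mathcal{D})=\min_i|A_i|$ and $\operatorname{sdepth}(M)$ is the maximum of $\operatorname{sdepth}(\mathcal{D})$ over all Stanley decompositions $\mathcal{D}$ of $M$. *)

theory Defs
  imports
    "HOL-Algebra.QuotRing"
    "HOL-Algebra.Module"
    "HOL-Library.Poly_Mapping"
    "HOL-Library.FuncSet"
    "Graph_Theory.Pair_Digraph"
begin

section \<open>Polynomial rings\<close>

text \<open>Monomials are finitely supported exponent functions, and the set \<^term>\<open>V\<close> of variables
  is a parameter, so that \<open>K[A]\<close> for \<open>A \<subseteq> V\<close> is a subset of \<open>K[V]\<close>.\<close>

type_synonym ('x, 'k) mpol = "('x \<Rightarrow>\<^sub>0 nat) \<Rightarrow>\<^sub>0 'k"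

definition polys :: "'x set \<Rightarrow> ('x, 'k::field) mpol set" where
  "polys V = {p. \<forall>m \<in> Poly_Mapping.keys p. Poly_Mapping.keys m \<subseteq> V}"

definition poly_ring :: "'x set \<Rightarrow> ('x, 'k::field) mpol ring" where
  "poly_ring V = \<lparr>carrier = polys V, monoid.mult = (*), one = 1, zero = 0, add = (+)\<rparr>"

definition pvar :: "'x \<Rightarrow> ('x, 'k::field) mpol" where
  "pvar v = Poly_Mapping.single (Poly_Mapping.single v 1) 1"

text \<open>The component of \<open>K[V]\<close> of multidegree \<open>a\<close>. Multidegrees are functions on the whole
  type of variables; the component is zero if \<open>a\<close> is somewhere negative or nonzero outside \<open>V\<close>,
  so the indices that matter are those in \<open>\<int>\<^sup>V\<close>.\<close>

definition poly_comp :: "'x set \<Rightarrow> ('x \<Rightarrow> int) \<Rightarrow> ('x, 'k::field) mpol set" where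
  "poly_comp V a =
     {p \<in> polys V. \<forall>m \<in> Poly_Mapping.keys p. \<forall>v. int (Poly_Mapping.lookup m v) = a v}"


section \<open>Multigraded modules\<close>

text \<open>A module together with the family of its homogeneous components. As for every
  \<^typ>\<open>('a, 'b) module\<close>, the fields \<^const>\<open>monoid.mult\<close> and \<^const>\<open>monoid.one\<close> carry no information.\<close>

record ('x, 'a, 'b) graded_module = "('a, 'b) module" +
  hcomp :: "('x \<Rightarrow> int) \<Rightarrow> 'b set"

definition ideal_module ::
  "'x set \<Rightarrow> ('x, 'k::field) mpol set \<Rightarrow> ('x, ('x, 'k) mpol, ('x, 'k) mpol) graded_module" where
  "ideal_module V I =
     \<lparr>carrier = I, monoid.mult = (*), one = 1, zero = 0, add = (+), smult = (*),
      hcomp = (\<lambda>a. I \<inter> poly_comp V a)\<rparr>"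

definition quotient_module ::
  "'x set \<Rightarrow> ('x, 'k::field) mpol set \<Rightarrow> ('x, ('x, 'k) mpol, ('x, 'k) mpol set) graded_module" where
  "quotient_module V I =
     (let S = poly_ring V; Q = S Quot I in
      \<lparr>carrier = carrier Q, monoid.mult = monoid.mult Q, one = one Q, zero = zero Q, add = add Q,
       smult = (\<lambda>p X. (I +>\<^bsub>S\<^esub> p) \<otimes>\<^bsub>Q\<^esub> X),
       hcomp = (\<lambda>a. (\<lambda>p. I +>\<^bsub>S\<^esub> p) ` poly_comp V a)\<rparr>)"


section \<open>Stanley depth\<close>

text \<open>\<open>w K[A]\<close>; lemma \<open>stanley_space_eq_span\<close> below confirms that this is the \<open>K\<close>-span of
  the elements \<open>w u\<close>, where \<open>u\<close> runs over the monomials in \<open>K[A]\<close>.\<close>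

definition stanley_space ::
  "('x, ('x, 'k::field) mpol, 'b) graded_module \<Rightarrow> 'b \<Rightarrow> 'x set \<Rightarrow> 'b set" where
  "stanley_space M w A = (\<lambda>p. p \<odot>\<^bsub>M\<^esub> w) ` polys A"

text \<open>Freeness is freeness with basis \<open>{w}\<close>; this excludes only \<open>w = 0\<close> from the reading in which
  the zero module counts as free on the empty basis.\<close>

definition stanley_free ::
  "('x, ('x, 'k::field) mpol, 'b) graded_module \<Rightarrow> 'b \<Rightarrow> 'x set \<Rightarrow> bool" where
  "stanley_free M w A \<longleftrightarrow> (\<forall>p \<in> polys A. p \<odot>\<^bsub>M\<^esub> w = \<zero>\<^bsub>M\<^esub> \<longrightarrow> p = 0)"

definition homogeneous :: "('x, 'a, 'b) graded_module \<Rightarrow> 'b \<Rightarrow> bool" where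
  "homogeneous M w \<longleftrightarrow> (\<exists>a. w \<in> hcomp M a)"

definition stanley_decomposition ::
  "'x set \<Rightarrow> ('x, ('x, 'k::field) mpol, 'b) graded_module \<Rightarrow> ('b \<times> 'x set) list \<Rightarrow> bool" where
  "stanley_decomposition V M D \<longleftrightarrow>
     (\<forall>(w, A) \<in> set D. w \<in> carrier M \<and> homogeneous M w \<and> A \<subseteq> V \<and> stanley_free M w A) \<and>
     (\<forall>x \<in> carrier M.
        \<exists>!z. z \<in> (\<Pi>\<^sub>E i \<in> {..<length D}. stanley_space M (fst (D ! i)) (snd (D ! i))) \<and>
             x = (\<Oplus>\<^bsub>M\<^esub>i \<in> {..<length D}. z i))"

definition decomposition_sdepth :: "('b \<times> 'x set) list \<Rightarrow> nat" where
  "decomposition_sdepth D = Min ((\<lambda>(w, A). card A) ` set D)"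

text \<open>Intended for a finite set \<open>V\<close> of variables and a nonzero finitely generated multigraded
  \<open>K[V]\<close>-module \<open>M\<close>. The values are then bounded by \<open>card V\<close>, and \<open>D\<close> is never empty.\<close>

definition sdepth :: "'x set \<Rightarrow> ('x, ('x, 'k::field) mpol, 'b) graded_module \<Rightarrow> nat" where
  "sdepth V M = Max {decomposition_sdepth D | D. stanley_decomposition V M D}"


section \<open>Graphs and edge ideals\<close>

text \<open>A finite simple graph is a \<^locale>\<open>pair_graph\<close>: an undirected edge is represented by its two
  orientations.\<close>

definition path_graph :: "nat \<Rightarrow> nat pair_pre_digraph" where
  "path_graph n =
     \<lparr>pverts = {1..n}, parcs = {(i, j). i \<in> {1..n} \<and> j \<in> {1..n} \<and> (j = i + 1 \<or> i = j + 1)}\<rparr>"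

definition strong_product ::
  "'a pair_pre_digraph \<Rightarrow> 'b pair_pre_digraph \<Rightarrow> ('a \<times> 'b) pair_pre_digraph" (infixl \<open>\<boxtimes>\<close> 70) where
  "G \<boxtimes> H =
     \<lparr>pverts = pverts G \<times> pverts H,
      parcs = {((v1, u1), (v2, u2)).
        (v1, u1) \<in> pverts G \<times> pverts H \<and> (v2, u2) \<in> pverts G \<times> pverts H \<and>
        (v1, u1) \<noteq> (v2, u2) \<and>
        (v1 = v2 \<or> (v1, v2) \<in> parcs G) \<and> (u1 = u2 \<or> (u1, u2) \<in> parcs H)}\<rparr>"

definition edge_ideal :: "'x pair_pre_digraph \<Rightarrow> ('x, 'k::field) mpol set" where
  "edge_ideal G = Idl\<^bsub>poly_ring (pverts G)\<^esub> {pvar u * pvar v | u v. (u, v) \<in> parcs G}"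

text \<open>\<open>x\<^sub>i\<^sub>j\<close> is the variable \<open>(i, j)\<close>.\<close>

abbreviation strong_grid :: "nat \<Rightarrow> nat \<Rightarrow> (nat \<times> nat) pair_pre_digraph" where
  "strong_grid n m \<equiv> path_graph n \<boxtimes> path_graph m"


section \<open>The definitions yield the intended structures\<close>

lemma polys_0: "0 \<in> polys V" and polys_1: "1 \<in> polys V"
  by (auto simp: polys_def)

lemma polys_add: "p \<in> polys V \<Longrightarrow> q \<in> polys V \<Longrightarrow> p + q \<in> polys V"
  using Poly_Mapping.keys_add[of p q] by (auto simp: polys_def)

lemma polys_uminus: "p \<in> polys V \<Longrightarrow> - p \<in> polys V"
  by (auto simp: polys_def)

lemma polys_mult: "p \<in> polys V \<Longrightarrow> q \<in> polys V \<Longrightarrow> p * q \<in> polys V"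
  unfolding polys_def
proof clarify
  fix m x
  assume p: "\<forall>m \<in> Poly_Mapping.keys p. Poly_Mapping.keys m \<subseteq> V"
    and q: "\<forall>m \<in> Poly_Mapping.keys q. Poly_Mapping.keys m \<subseteq> V"
    and m: "m \<in> Poly_Mapping.keys (p * q)" and x: "x \<in> Poly_Mapping.keys m"
  from m obtain a b where "a \<in> Poly_Mapping.keys p" "b \<in> Poly_Mapping.keys q" "m = a + b"
    using keys_mult[of p q] by blast
  with p q x Poly_Mapping.keys_add[of a b] show "x \<in> V" by blast
qed

lemma polys_single: "Poly_Mapping.keys u \<subseteq> V \<Longrightarrow> Poly_Mapping.single u c \<in> polys V"
  by (auto simp: polys_def)

lemma polys_mono: "A \<subseteq> V \<Longrightarrow> polys A \<subseteq> polys V"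
  by (auto simp: polys_def)

lemma cring_poly_ring: "cring (poly_ring V :: ('x, 'k::field) mpol ring)" (is "cring ?S")
proof (rule cringI)
  show "abelian_group ?S"
  proof (rule abelian_groupI)
    fix p assume "p \<in> carrier ?S"
    then show "\<exists>q \<in> carrier ?S. q \<oplus>\<^bsub>?S\<^esub> p = \<zero>\<^bsub>?S\<^esub>"
      by (intro bexI[of _ "- p"]) (auto simp: poly_ring_def polys_uminus)
  qed (auto simp: poly_ring_def polys_add polys_0 add_ac)
  show "comm_monoid ?S"
  proof (rule comm_monoidI)
    fix p q r :: "('x, 'k) mpol"
    show "p \<otimes>\<^bsub>?S\<^esub> q \<otimes>\<^bsub>?S\<^esub> r = p \<otimes>\<^bsub>?S\<^esub> (q \<otimes>\<^bsub>?S\<^esub> r)"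
      by (simp add: poly_ring_def mult.assoc)
    show "p \<otimes>\<^bsub>?S\<^esub> q = q \<otimes>\<^bsub>?S\<^esub> p"
      by (simp add: poly_ring_def mult.commute)
  qed (simp_all add: poly_ring_def polys_mult polys_1)
  fix p q r :: "('x, 'k) mpol"
  show "(p \<oplus>\<^bsub>?S\<^esub> q) \<otimes>\<^bsub>?S\<^esub> r = p \<otimes>\<^bsub>?S\<^esub> r \<oplus>\<^bsub>?S\<^esub> q \<otimes>\<^bsub>?S\<^esub> r"
    by (simp add: poly_ring_def distrib_right)
qed

lemma ideal_edge_ideal:
  assumes "pair_graph G"
  shows "ideal (edge_ideal G) (poly_ring (pverts G))"
proof -
  interpret pair_graph G by fact
  interpret S: cring "poly_ring (pverts G)" by (rule cring_poly_ring)
  have "pvar u \<in> polys (pverts G)" if "u \<in> pverts G" for u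
    using that by (auto simp: pvar_def intro!: polys_single)
  then show ?thesis unfolding edge_ideal_def
    by (intro S.genideal_ideal) (auto simp: poly_ring_def intro!: polys_mult dest: in_arcsD1 in_arcsD2)
qed

lemma pair_graph_path_graph: "pair_graph (path_graph n)"
proof unfold_locales
  show "finite (parcs (path_graph n))"
    by (rule finite_subset[of _ "{1..n} \<times> {1..n}"]) (auto simp: path_graph_def)
qed (auto simp: path_graph_def symmetric_def intro: symI)

lemma pair_graph_strong_product:
  assumes "pair_graph G" "pair_graph H"
  shows "pair_graph (G \<boxtimes> H)"
proof -
  interpret G: pair_graph G by fact
  interpret H: pair_graph H by fact
  have sym: "(b, a) \<in> parcs G" if "(a, b) \<in> parcs G" for a b
    using G.pair_sym_arcs that by (auto simp: symmetric_def dest: symD)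
  have sym': "(b, a) \<in> parcs H" if "(a, b) \<in> parcs H" for a b
    using H.pair_sym_arcs that by (auto simp: symmetric_def dest: symD)
  show ?thesis
  proof unfold_locales
    show "finite (parcs (G \<boxtimes> H))"
      by (rule finite_subset[of _ "(pverts G \<times> pverts H) \<times> (pverts G \<times> pverts H)"])
         (auto simp: strong_product_def G.pair_finite_verts H.pair_finite_verts)
    show "symmetric (G \<boxtimes> H)"
      by (auto simp: symmetric_def strong_product_def intro!: symI dest: sym sym')
  qed (auto simp: strong_product_def G.pair_finite_verts H.pair_finite_verts)
qed

lemma strong_grid_arcs_iff:
  assumes "i \<in> {1..n}" "k \<in> {1..n}" "j \<in> {1..m}" "l \<in> {1..m}" "(i, j) \<noteq> (k, l)"
  shows "((i, j), (k, l)) \<in> parcs (strong_grid n m) \<longleftrightarrow>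
         \<bar>int i - int k\<bar> \<le> 1 \<and> \<bar>int j - int l\<bar> \<le> 1"
  using assms by (auto simp: strong_product_def path_graph_def)

lemma module_ideal_module:
  assumes "ideal I (poly_ring V)"
  shows "Module.module (poly_ring V) (ideal_module V I)"
proof -
  interpret ideal I "poly_ring V" by fact
  have I: "I \<subseteq> polys V" using a_subset by (simp add: poly_ring_def)
  have uminus: "- x \<in> I" if "x \<in> I" for x
    using I_l_closed[OF that, of "-1"] by (auto simp: poly_ring_def polys_uminus polys_1)
  have mult: "p * x \<in> I" if "p \<in> polys V" "x \<in> I" for p x
    using I_l_closed[of x p] that by (simp add: poly_ring_def)
  show ?thesis
  proof (rule moduleI[OF cring_poly_ring])
    show "abelian_group (ideal_module V I)"
    proof (rule abelian_groupI)
      fix p assume "p \<in> carrier (ideal_module V I)"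
      then show "\<exists>q \<in> carrier (ideal_module V I). q \<oplus>\<^bsub>ideal_module V I\<^esub> p = \<zero>\<^bsub>ideal_module V I\<^esub>"
        by (intro bexI[of _ "- p"]) (auto simp: ideal_module_def uminus)
    qed (use additive_subgroup.a_closed[OF is_additive_subgroup] additive_subgroup.zero_closed[OF is_additive_subgroup] in
      \<open>auto simp: ideal_module_def poly_ring_def add_ac\<close>)
  qed (use mult in \<open>simp_all add: ideal_module_def poly_ring_def distrib_left distrib_right mult.assoc\<close>)
qed

lemma module_quotient_module:
  assumes "ideal I (poly_ring V)"
  shows "Module.module (poly_ring V) (quotient_module V I)"
proof -
  interpret ideal I "poly_ring V" by fact
  interpret S: cring "poly_ring V" by (rule cring_poly_ring)
  interpret Q: cring "poly_ring V Quot I" by (rule quotient_is_cring[OF S.is_cring])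
  interpret h: ring_hom_ring "poly_ring V" "poly_ring V Quot I" "(+>\<^bsub>poly_ring V\<^esub>) I"
    by (rule rcos_ring_hom_ring)
  note [simp] = quotient_module_def Let_def
  show ?thesis
  proof (rule moduleI[OF cring_poly_ring])
    show "abelian_group (quotient_module V I)"
    proof (rule abelian_groupI)
      fix X assume "X \<in> carrier (quotient_module V I)"
      then show "\<exists>Y \<in> carrier (quotient_module V I).
          Y \<oplus>\<^bsub>quotient_module V I\<^esub> X = \<zero>\<^bsub>quotient_module V I\<^esub>"
        by (intro bexI[of _ "\<ominus>\<^bsub>poly_ring V Quot I\<^esub> X"]) (auto simp: Q.l_neg)
    qed (auto simp: Q.a_ac)
  qed (auto simp: Q.l_distr Q.r_distr Q.m_assoc)
qed

lemma finsum_poly_ring: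
  assumes "finite U" "\<And>u. u \<in> U \<Longrightarrow> f u \<in> polys V"
  shows "(\<Oplus>\<^bsub>poly_ring V\<^esub>u \<in> U. f u) = (\<Sum>u \<in> U. f u)"
proof -
  interpret S: cring "poly_ring V" by (rule cring_poly_ring)
  show ?thesis using assms
  proof (induction U rule: finite_induct)
    case empty
    show ?case using S.finsum_empty[of f] by (simp add: poly_ring_def)
  next
    case (insert u U)
    have "finsum (poly_ring V) f (insert u U) = f u \<oplus>\<^bsub>poly_ring V\<^esub> finsum (poly_ring V) f U"
      by (rule S.finsum_insert) (use insert in \<open>auto simp: poly_ring_def\<close>)
    then show ?case using insert by (simp add: poly_ring_def)
  qed
qed

lemma stanley_space_eq_span:
  fixes M :: "('x, ('x, 'k::field) mpol, 'b) graded_module"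
  assumes "Module.module (poly_ring V) M" "w \<in> carrier M" "A \<subseteq> V"
  shows "stanley_space M w A =
    {(\<Oplus>\<^bsub>M\<^esub>u \<in> U. Poly_Mapping.single 0 (c u) \<odot>\<^bsub>M\<^esub> (Poly_Mapping.single u 1 \<odot>\<^bsub>M\<^esub> w)) | U c.
       finite U \<and> (\<forall>u \<in> U. Poly_Mapping.keys u \<subseteq> A)}"
proof -
  interpret Module.module "poly_ring V" M by fact
  have *: "(\<Oplus>\<^bsub>M\<^esub>u \<in> U. Poly_Mapping.single 0 (c u) \<odot>\<^bsub>M\<^esub> (Poly_Mapping.single u 1 \<odot>\<^bsub>M\<^esub> w)) =
      (\<Sum>u \<in> U. Poly_Mapping.single u (c u)) \<odot>\<^bsub>M\<^esub> w"
    if U: "finite U" "\<forall>u \<in> U. Poly_Mapping.keys u \<subseteq> A" for U c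
  proof -
    have c: "Poly_Mapping.single u (c u) \<in> polys V" if "u \<in> U" for u
      using U that assms(3) by (auto intro!: polys_single)
    have "(\<Oplus>\<^bsub>M\<^esub>u \<in> U. Poly_Mapping.single 0 (c u) \<odot>\<^bsub>M\<^esub> (Poly_Mapping.single u 1 \<odot>\<^bsub>M\<^esub> w)) =
        (\<Oplus>\<^bsub>M\<^esub>u \<in> U. Poly_Mapping.single u (c u) \<odot>\<^bsub>M\<^esub> w)"
    proof (rule M.finsum_cong')
      fix u assume "u \<in> U"
      then have "Poly_Mapping.single u (1::'k) \<in> polys V" "Poly_Mapping.single 0 (c u) \<in> polys V"
        using U assms(3) by (auto intro!: polys_single)
      then show "Poly_Mapping.single 0 (c u) \<odot>\<^bsub>M\<^esub> (Poly_Mapping.single u 1 \<odot>\<^bsub>M\<^esub> w) =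
          Poly_Mapping.single u (c u) \<odot>\<^bsub>M\<^esub> w"
        using smult_assoc1[of "Poly_Mapping.single 0 (c u)" "Poly_Mapping.single u 1" w] assms(2)
        by (auto simp: poly_ring_def mult_single)
    qed (use c assms(2) in \<open>auto simp: poly_ring_def intro!: smult_closed\<close>)
    also have "\<dots> = (\<Oplus>\<^bsub>poly_ring V\<^esub>u \<in> U. Poly_Mapping.single u (c u)) \<odot>\<^bsub>M\<^esub> w"
      using U(1) c
    proof (induction U rule: finite_induct)
      case (insert u U)
      then have "Poly_Mapping.single v (c v) \<in> carrier (poly_ring V)" if "v \<in> insert u U" for v
        using that by (simp add: poly_ring_def)
      with insert assms(2) show ?case
        by (simp add: Pi_def smult_l_distr)
    qed (simp add: assms(2))
    finally show ?thesis using finsum_poly_ring[OF U(1) c] by simp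
  qed
  show ?thesis (is "_ = ?R")
  proof (intro equalityI subsetI)
    fix x assume "x \<in> stanley_space M w A"
    then obtain p where p: "p \<in> polys A" "x = p \<odot>\<^bsub>M\<^esub> w" by (auto simp: stanley_space_def)
    have "p = (\<Sum>u \<in> Poly_Mapping.keys p. Poly_Mapping.single u (Poly_Mapping.lookup p u))"
      by (rule poly_mapping_eqI) (simp add: lookup_sum lookup_single when_def in_keys_iff)
    with p *[of "Poly_Mapping.keys p" "Poly_Mapping.lookup p"] show "x \<in> ?R"
      by (auto simp: polys_def intro!: exI[of _ "Poly_Mapping.keys p"] exI[of _ "Poly_Mapping.lookup p"])
  next
    fix x assume "x \<in> ?R"
    then obtain U c where U: "finite U" "\<forall>u \<in> U. Poly_Mapping.keys u \<subseteq> A"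
      and x: "x = (\<Sum>u \<in> U. Poly_Mapping.single u (c u)) \<odot>\<^bsub>M\<^esub> w"
      using * by auto
    have "(\<Sum>u \<in> U. Poly_Mapping.single u (c u)) \<in> polys A"
      using U by (induction U rule: finite_induct) (auto simp: polys_0 intro!: polys_add polys_single)
    then show "x \<in> stanley_space M w A" using x by (auto simp: stanley_space_def)
  qed
qed

end

theory Submission
  imports Defs
begin

text \<open>
  Both modules have a \<open>K\<close>-basis of monomials, and whether a monomial belongs to the edge ideal \<open>I\<close>
  depends only on its support: the monomials in \<open>I\<close> are those with dependent support, and the
  monomials with independent support form a basis of \<open>S/I\<close>. A partition of a family of supports
  into intervals \<open>[C, D]\<close> therefore gives a Stanley decomposition with summands \<open>x\<^sup>C K[D]\<close>, because
  the monomials in \<open>x\<^sup>C K[D]\<close> are exactly those with support between \<open>C\<close> and \<open>D\<close>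
  (\<open>stanley_decomposition_of_interval_partition\<close>). Lower bounds for Stanley depth thus follow from
  interval partitions in which every upper end \<open>D\<close> is large.

  For the independent sets of the grid with \<open>n\<close> columns and two rows, the partition is built by
  recursion on the last columns: either the last column but one is occupied, and three columns are
  used up for one vertex, or it is empty, and two columns are used up, the last column
  contributing \<open>[\<emptyset>, {x}]\<close> and \<open>[{y}, {y}]\<close>. This gives upper ends of size at least \<open>\<lceil>n/3\<rceil>\<close>. A dependent
  set has its last column free over a dependent rest, or contains the whole last column over an
  independent rest, or has an edge between the last two columns over an independent rest in the first
  \<open>n - 3\<close> columns. The last two cases contribute two vertices, and the independent rest supplies
  \<open>\<lceil>(n-1)/3\<rceil>\<close>, respectively \<open>\<lceil>(n-3)/3\<rceil>\<close>, more; this gives upper ends of size at least \<open>\<lceil>n/3\<rceil> + 1\<close>.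

  The upper bound for \<open>S/I\<close> comes from a maximal independent set \<open>T\<close>: in any Stanley decomposition
  some summand \<open>w K[A]\<close> has \<open>x\<^sup>T\<close> in the support of one of its elements, and multiplying by a
  variable outside \<open>T\<close> kills the monomial \<open>x\<^sup>T\<close>, so freeness forces \<open>A \<subseteq> T\<close>
  (\<open>decomposition_sdepth_quotient_le\<close>). Every third column yields such a \<open>T\<close> with \<open>\<lceil>n/3\<rceil>\<close> elements.

  The number \<open>\<lceil>n/3\<rceil>\<close> appears as \<open>(n + 2) div 3\<close> below.
\<close>

section \<open>Families of sets partitioned into intervals\<close>

text \<open>The intervals are added one at a time, so disjointness of the parts is a condition on each
  step, and constructions on partitions are inductions over the parts.\<close>
inductive interval_partitionable :: "nat \<Rightarrow> 'a set set \<Rightarrow> bool" for k where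
  empty: "interval_partitionable k {}"
| insert: "interval_partitionable k F \<Longrightarrow> C \<subseteq> D \<Longrightarrow> finite D \<Longrightarrow> k \<le> card D \<Longrightarrow> {C..D} \<inter> F = {}
    \<Longrightarrow> interval_partitionable k ({C..D} \<union> F)"

lemma interval_partitionable_interval:
  "C \<subseteq> D \<Longrightarrow> finite D \<Longrightarrow> k \<le> card D \<Longrightarrow> interval_partitionable k {C..D}"
  using interval_partitionable.insert[OF interval_partitionable.empty, of C D k] by simp

lemma interval_partitionable_Un:
  assumes "interval_partitionable k F" "interval_partitionable k G" "F \<inter> G = {}"
  shows "interval_partitionable k (F \<union> G)"
  using assms
proof (induction rule: interval_partitionable.induct)
  case (insert F C D)
  have "interval_partitionable k ({C..D} \<union> (F \<union> G))"
    by (rule interval_partitionable.insert) (use insert in auto)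
  then show ?case by (simp add: Un_assoc)
qed simp

lemma interval_partitionable_UN:
  assumes "finite J" "\<And>j. j \<in> J \<Longrightarrow> interval_partitionable k (F j)" "disjoint_family_on F J"
  shows "interval_partitionable k (\<Union>j \<in> J. F j)"
  using assms
proof (induction J rule: finite_induct)
  case (insert j J)
  have "F j \<inter> (\<Union>j \<in> J. F j) = {}"
    using insert.hyps(2) insert.prems(2) by (fastforce simp: disjoint_family_on_def)
  moreover have "disjoint_family_on F J"
    using insert.prems(2) by (auto simp: disjoint_family_on_def)
  ultimately show ?case
    using insert by (auto intro!: interval_partitionable_Un)
qed (simp add: interval_partitionable.empty)

lemma interval_partitionable_mono:
  assumes "interval_partitionable k F" "l \<le> k"
  shows "interval_partitionable l F"
  using assms by (induction rule: interval_partitionable.induct)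
    (auto intro!: interval_partitionable.intros)

text \<open>This is the step that builds partitions on a product of two disjoint ground sets: attaching
  \<open>[C, D]\<close> to an interval \<open>[C', D']\<close> over the other ground set gives \<open>[C \<union> C', D \<union> D']\<close>, and the sizes
  of the upper ends add up. The condition on \<open>X - D\<close> expresses the product without naming the
  ground set of \<open>F\<close>.\<close>
lemma interval_partitionable_join:
  assumes "interval_partitionable k F" "C \<subseteq> D" "finite D" "D \<inter> \<Union>F = {}"
  shows "interval_partitionable (card D + k) {X. C \<subseteq> X \<and> X - D \<in> F}"
  using assms
proof (induction rule: interval_partitionable.induct)
  case empty
  show ?case by (simp add: interval_partitionable.empty)
next
  case (insert F C' D')
  have disj: "D \<inter> D' = {}"
    using insert.hyps(2) insert.prems(3) by auto
  have "{X. C \<subseteq> X \<and> X - D \<in> {C'..D'} \<union> F} = {C \<union> C'..D \<union> D'} \<union> {X. C \<subseteq> X \<and> X - D \<in> F}"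
    using disj insert.hyps(2) by auto
  moreover have "interval_partitionable (card D + k) ({C \<union> C'..D \<union> D'} \<union> {X. C \<subseteq> X \<and> X - D \<in> F})"
  proof (rule interval_partitionable.insert)
    show "interval_partitionable (card D + k) {X. C \<subseteq> X \<and> X - D \<in> F}"
      using insert.IH insert.prems by blast
    show "card D + k \<le> card (D \<union> D')"
      using insert disj by (simp add: card_Un_disjoint)
    have "X - D \<in> {C'..D'}" if "X \<in> {C \<union> C'..D \<union> D'}" for X
      using that disj insert.hyps(2) by auto
    then show "{C \<union> C'..D \<union> D'} \<inter> {X. C \<subseteq> X \<and> X - D \<in> F} = {}"
      using insert.hyps(5) by blast
  qed (use insert.hyps insert.prems in auto)
  ultimately show ?case by simp
qed

text \<open>Stanley decompositions are lists of summands; the third property says that the intervals at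
  different positions are disjoint.\<close>
lemma interval_partitionable_list:
  assumes "interval_partitionable k F"
  obtains L where "\<And>C D. (C, D) \<in> set L \<Longrightarrow> C \<subseteq> D \<and> finite D \<and> k \<le> card D"
    and "\<And>X. X \<in> F \<longleftrightarrow> (\<exists>i < length L. X \<in> {fst (L ! i)..snd (L ! i)})"
    and "\<And>X i j. i < length L \<Longrightarrow> j < length L \<Longrightarrow> X \<in> {fst (L ! i)..snd (L ! i)}
       \<Longrightarrow> X \<in> {fst (L ! j)..snd (L ! j)} \<Longrightarrow> i = j"
proof -
  have "\<exists>L. (\<forall>C D. (C, D) \<in> set L \<longrightarrow> C \<subseteq> D \<and> finite D \<and> k \<le> card D) \<and>
    (\<forall>X. X \<in> F \<longleftrightarrow> (\<exists>i < length L. X \<in> {fst (L ! i)..snd (L ! i)})) \<and>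
    (\<forall>X i j. i < length L \<longrightarrow> j < length L \<longrightarrow> X \<in> {fst (L ! i)..snd (L ! i)}
       \<longrightarrow> X \<in> {fst (L ! j)..snd (L ! j)} \<longrightarrow> i = j)"
    using assms
  proof (induction rule: interval_partitionable.induct)
    case empty
    show ?case by (intro exI[of _ "[]"]) simp
  next
    case (insert F C D)
    from insert.IH obtain L where L: "\<And>C D. (C, D) \<in> set L \<Longrightarrow> C \<subseteq> D \<and> finite D \<and> k \<le> card D"
      "\<And>X. X \<in> F \<longleftrightarrow> (\<exists>i < length L. X \<in> {fst (L ! i)..snd (L ! i)})"
      "\<And>X i j. i < length L \<Longrightarrow> j < length L \<Longrightarrow> X \<in> {fst (L ! i)..snd (L ! i)}
         \<Longrightarrow> X \<in> {fst (L ! j)..snd (L ! j)} \<Longrightarrow> i = j"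
      by metis
    let ?L = "(C, D) # L"
    have ex: "(\<exists>i < length ?L. P i) \<longleftrightarrow> P 0 \<or> (\<exists>i < length L. P (Suc i))" for P
      using Ex_less_Suc2[of "length L" P] by simp
    have uniq: "i = j" if "i < length ?L" "j < length ?L" "X \<in> {fst (?L ! i)..snd (?L ! i)}"
        "X \<in> {fst (?L ! j)..snd (?L ! j)}" for X i j
    proof (cases i; cases j)
      fix i' j' assume ij: "i = Suc i'" "j = Suc j'"
      then show ?thesis using L(3)[of i' j' X] that by simp
    next
      fix j' assume ij: "i = 0" "j = Suc j'"
      then have "X \<in> F" "X \<in> {C..D}" using L(2)[of X] that by auto
      then show ?thesis using insert.hyps(5) by blast
    next
      fix i' assume ij: "i = Suc i'" "j = 0"
      then have "X \<in> F" "X \<in> {C..D}" using L(2)[of X] that by auto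
      then show ?thesis using insert.hyps(5) by blast
    qed simp
    have mem: "X \<in> {C..D} \<union> F \<longleftrightarrow> (\<exists>i < length ?L. X \<in> {fst (?L ! i)..snd (?L ! i)})" for X
      unfolding ex using L(2)[of X] by simp
    have "\<forall>C' D'. (C', D') \<in> set ?L \<longrightarrow> C' \<subseteq> D' \<and> finite D' \<and> k \<le> card D'"
      using insert.hyps L(1) by (metis Pair_inject set_ConsD)
    with mem uniq show ?case by blast
  qed
  with that show ?thesis by metis
qed

section \<open>Spaces spanned by monomials with prescribed supports\<close>

abbreviation keys :: "('a \<Rightarrow>\<^sub>0 'b::zero) \<Rightarrow> 'a set" where
  "keys \<equiv> Poly_Mapping.keys"
abbreviation lookup :: "('a \<Rightarrow>\<^sub>0 'b::zero) \<Rightarrow> 'a \<Rightarrow> 'b" where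
  "lookup \<equiv> Poly_Mapping.lookup"
abbreviation single :: "'a \<Rightarrow> 'b \<Rightarrow> ('a \<Rightarrow>\<^sub>0 'b::zero)" where
  "single \<equiv> Poly_Mapping.single"

definition monomial_span :: "'x set set \<Rightarrow> ('x, 'k::field) mpol set" where
  "monomial_span F = {p. \<forall>m \<in> keys p. keys m \<in> F}"

lemma monomial_span_iff: "p \<in> monomial_span F \<longleftrightarrow> (\<forall>m. keys m \<notin> F \<longrightarrow> lookup p m = 0)"
  by (auto simp: monomial_span_def in_keys_iff)

lemma polys_eq_monomial_span: "polys V = monomial_span (Pow V)"
  by (auto simp: polys_def monomial_span_def)

lemma monomial_span_mono: "F \<subseteq> G \<Longrightarrow> monomial_span F \<subseteq> monomial_span G"
  by (auto simp: monomial_span_def)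

lemma monomial_span_zero: "0 \<in> monomial_span F"
  by (simp add: monomial_span_iff)

lemma monomial_span_add: "p \<in> monomial_span F \<Longrightarrow> q \<in> monomial_span F \<Longrightarrow> p + q \<in> monomial_span F"
  by (simp add: monomial_span_iff lookup_add)

lemma monomial_span_diff: "p \<in> monomial_span F \<Longrightarrow> q \<in> monomial_span F \<Longrightarrow> p - q \<in> monomial_span F"
  by (simp add: monomial_span_iff lookup_minus)

lemma monomial_span_sum: "(\<And>i. i \<in> J \<Longrightarrow> q i \<in> monomial_span F) \<Longrightarrow> sum q J \<in> monomial_span F"
  by (simp add: monomial_span_iff lookup_sum)

lemma monomial_span_single: "keys m \<in> F \<Longrightarrow> single m c \<in> monomial_span F"
  by (auto simp: monomial_span_def)

lemma keys_add_nat: "keys (a + b) = keys a \<union> keys (b :: 'x \<Rightarrow>\<^sub>0 nat)"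
  by (auto simp: in_keys_iff lookup_add)

lemma sum_single_lookup: "(\<Sum>m \<in> keys p. single m (lookup p m)) = p"
  by (rule poly_mapping_eqI) (simp add: lookup_sum lookup_single when_def in_keys_iff)

text \<open>The projection onto \<^term>\<open>monomial_span F\<close> along the monomials with supports outside \<open>F\<close>.\<close>
definition restrict_support :: "'x set set \<Rightarrow> ('x, 'k::field) mpol \<Rightarrow> ('x, 'k) mpol" where
  "restrict_support F p = (\<Sum>m \<in> {m \<in> keys p. keys m \<in> F}. single m (lookup p m))"

lemma lookup_restrict_support:
  "lookup (restrict_support F p) m = (if keys m \<in> F then lookup p m else 0)"
  by (auto simp: restrict_support_def lookup_sum lookup_single when_def in_keys_iff)

lemma restrict_support_in: "restrict_support F p \<in> monomial_span F"
  by (simp add: monomial_span_iff lookup_restrict_support)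

text \<open>The exponent of \<open>x\<^sup>C\<close>, the product of the variables in \<open>C\<close>.\<close>
definition squarefree_exponent :: "'x set \<Rightarrow> 'x \<Rightarrow>\<^sub>0 nat" where
  "squarefree_exponent C = (\<Sum>v \<in> C. single v 1)"

lemma lookup_squarefree_exponent:
  "finite C \<Longrightarrow> lookup (squarefree_exponent C) v = (if v \<in> C then 1 else 0)"
  by (simp add: squarefree_exponent_def lookup_sum lookup_single when_def)

lemma keys_squarefree_exponent: "finite C \<Longrightarrow> keys (squarefree_exponent C) = C"
  by (auto simp: in_keys_iff lookup_squarefree_exponent split: if_splits)

lemma times_monomial:
  fixes p :: "('x, 'k::field) mpol"
  shows "p * single u 1 = (\<Sum>m \<in> keys p. single (m + u) (lookup p m))"
proof -
  have "p * single u 1 = (\<Sum>m \<in> keys p. single m (lookup p m)) * single u 1"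
    by (simp add: sum_single_lookup)
  then show ?thesis by (simp add: sum_distrib_right mult_single)
qed

lemma lookup_times_monomial:
  fixes p :: "('x, 'k::field) mpol"
  shows "lookup (p * single u 1) (m + u) = lookup p m"
  by (simp add: times_monomial lookup_sum lookup_single when_def in_keys_iff)

lemma times_monomial_eq_0_iff:
  fixes p :: "('x, 'k::field) mpol"
  shows "p * single u 1 = 0 \<longleftrightarrow> p = 0"
proof
  assume "p * single u 1 = 0"
  then have "lookup p m = 0" for m using lookup_times_monomial[of p u m] by simp
  then show "p = 0" by (intro poly_mapping_eqI) simp
qed simp

text \<open>Membership of a monomial in \<open>x\<^sup>C K[D]\<close> is a condition on its support only: it is divisible by
  \<open>x\<^sup>C\<close> iff its support contains \<open>C\<close>, and for \<open>C \<subseteq> D\<close> the quotient lies in \<open>K[D]\<close> iff its support is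
  contained in \<open>D\<close>.\<close>
lemma monomial_times_polys:
  assumes "C \<subseteq> D" "finite D"
  shows "(\<lambda>p. p * single (squarefree_exponent C) 1) ` polys D =
    (monomial_span {C..D} :: ('x, 'k::field) mpol set)"
proof (intro equalityI subsetI)
  have C: "finite C" using assms finite_subset by blast
  fix q :: "('x, 'k) mpol"
  assume "q \<in> (\<lambda>p. p * single (squarefree_exponent C) 1) ` polys D"
  then obtain p where p: "p \<in> polys D" "q = p * single (squarefree_exponent C) 1" by blast
  show "q \<in> monomial_span {C..D}"
    unfolding p(2) times_monomial using p(1) assms(1) C
    by (intro monomial_span_sum monomial_span_single)
      (auto simp: polys_def keys_add_nat keys_squarefree_exponent)
next
  have C: "finite C" using assms finite_subset by blast
  fix q :: "('x, 'k) mpol" assume q: "q \<in> monomial_span {C..D}"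
  define p where "p = (\<Sum>m \<in> keys q. single (m - squarefree_exponent C) (lookup q m))"
  have "p \<in> polys D" unfolding p_def polys_eq_monomial_span
    using q by (intro monomial_span_sum monomial_span_single)
      (auto simp: monomial_span_def in_keys_iff lookup_minus subset_iff)
  moreover have "m - squarefree_exponent C + squarefree_exponent C = m" if "m \<in> keys q" for m
  proof (rule poly_mapping_eqI)
    fix v
    have "C \<subseteq> keys m" using q that by (auto simp: monomial_span_def)
    then have "v \<in> C \<Longrightarrow> 1 \<le> lookup m v" by (auto simp: in_keys_iff Suc_le_eq)
    then show "lookup (m - squarefree_exponent C + squarefree_exponent C) v = lookup m v"
      using C by (auto simp: lookup_add lookup_minus lookup_squarefree_exponent)
  qed
  then have "p * single (squarefree_exponent C) 1 = q"
    by (simp add: p_def sum_distrib_right mult_single sum_single_lookup)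
  ultimately show "q \<in> (\<lambda>p. p * single (squarefree_exponent C) 1) ` polys D" by blast
qed

definition dependent_sets :: "'x pair_pre_digraph \<Rightarrow> 'x set set" where
  "dependent_sets G = {X. X \<subseteq> pverts G \<and> (\<exists>(u, v) \<in> parcs G. u \<in> X \<and> v \<in> X)}"

definition independent_sets :: "'x pair_pre_digraph \<Rightarrow> 'x set set" where
  "independent_sets G = Pow (pverts G) - dependent_sets G"

text \<open>Dependence is inherited by larger sets of vertices, so the right-hand side is an ideal
  containing the generators; conversely, a monomial with dependent support is divisible by the
  product of the two ends of an edge.\<close>
lemma edge_ideal_eq_monomial_span:
  assumes "pair_graph G"
  shows "edge_ideal G = (monomial_span (dependent_sets G) :: ('x, 'k::field) mpol set)"
proof (rule equalityI)
  interpret pair_graph G by fact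
  let ?V = "pverts G" and ?J = "monomial_span (dependent_sets G) :: ('x, 'k) mpol set"
  let ?gens = "{pvar u * pvar v | u v. (u, v) \<in> parcs G} :: ('x, 'k) mpol set"
  interpret S: cring "poly_ring ?V :: ('x, 'k) mpol ring" by (rule cring_poly_ring)
  have gen: "pvar u * pvar v = (single (single u 1 + single v 1) 1 :: ('x, 'k) mpol)" for u v
    by (simp add: pvar_def mult_single)
  have J_sub: "?J \<subseteq> polys ?V"
    unfolding polys_eq_monomial_span by (rule monomial_span_mono) (auto simp: dependent_sets_def)
  have gens_sub: "?gens \<subseteq> ?J"
    unfolding gen
    by (auto intro!: monomial_span_single bexI[rotated]
        simp: dependent_sets_def keys_add_nat dest: in_arcsD1 in_arcsD2)
  have times: "p * q \<in> ?J" if "p \<in> ?J" "q \<in> polys ?V" for p q :: "('x, 'k) mpol"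
    unfolding monomial_span_def mem_Collect_eq
  proof
    fix m assume "m \<in> keys (p * q)"
    then obtain a b where ab: "a \<in> keys p" "b \<in> keys q" "m = a + b"
      using keys_mult[of p q] by blast
    then have "keys a \<in> dependent_sets G" "keys b \<subseteq> ?V"
      using that by (auto simp: monomial_span_def polys_def)
    then show "keys m \<in> dependent_sets G"
      unfolding ab(3) keys_add_nat dependent_sets_def by blast
  qed
  have uminus: "- p \<in> ?J" if "p \<in> ?J" for p :: "('x, 'k) mpol"
    using monomial_span_diff[OF monomial_span_zero that] by simp
  have inv: "\<ominus>\<^bsub>poly_ring ?V\<^esub> p = - p" if "p \<in> polys ?V" for p :: "('x, 'k) mpol"
    by (rule S.minus_equality) (use that in \<open>simp_all add: poly_ring_def polys_uminus\<close>)
  have "ideal ?J (poly_ring ?V)"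
  proof (rule idealI)
    show "ring (poly_ring ?V :: ('x, 'k) mpol ring)" by (rule S.ring_axioms)
    show "subgroup ?J (add_monoid (poly_ring ?V))"
    proof (rule S.add.subgroupI)
      fix p assume "p \<in> ?J"
      then show "\<ominus>\<^bsub>poly_ring ?V\<^esub> p \<in> ?J"
        using uminus inv J_sub by auto
    qed (use J_sub monomial_span_zero in \<open>auto simp: poly_ring_def monomial_span_add\<close>)
  qed (use times in \<open>auto simp: poly_ring_def mult.commute\<close>)
  then show "edge_ideal G \<subseteq> ?J"
    unfolding edge_ideal_def using gens_sub by (rule S.genideal_minimal)
  interpret I: ideal "edge_ideal G :: ('x, 'k) mpol set" "poly_ring ?V"
    by (rule ideal_edge_ideal[OF assms])
  have monomial: "single m c \<in> edge_ideal G" if m: "keys m \<in> dependent_sets G" for m and c :: 'k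
  proof -
    obtain u v where uv: "(u, v) \<in> parcs G" "u \<in> keys m" "v \<in> keys m" "keys m \<subseteq> ?V"
      using m by (auto simp: dependent_sets_def)
    let ?e = "single u 1 + single v 1"
    (* An edge has two different ends, so each of its variables needs to divide m only once. *)
    have "u \<noteq> v" using pair_no_loops[OF uv(1)] by simp
    then have m_eq: "m - ?e + ?e = m"
      using uv(2,3) by (intro poly_mapping_eqI)
        (auto simp: lookup_add lookup_minus lookup_single when_def in_keys_iff)
    have "keys (m - ?e) \<subseteq> ?V"
      using uv(4) by (auto simp: in_keys_iff lookup_minus subset_iff)
    then have "single (m - ?e) c \<in> polys ?V" by (rule polys_single)
    moreover have "pvar u * pvar v \<in> (edge_ideal G :: ('x, 'k) mpol set)"
      unfolding edge_ideal_def using J_sub gens_sub uv(1)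
      by (intro subsetD[OF S.genideal_self]) (auto simp: poly_ring_def)
    ultimately have "single (m - ?e) c * (pvar u * pvar v) \<in> edge_ideal G"
      using I.I_l_closed by (simp add: poly_ring_def)
    then show ?thesis by (simp only: gen mult_single m_eq mult_1_right)
  qed
  show "?J \<subseteq> edge_ideal G"
  proof
    fix p assume p: "p \<in> ?J"
    have "(\<Sum>m \<in> U. single m (lookup p m)) \<in> edge_ideal G" if "U \<subseteq> keys p" for U
      using finite_subset[OF that finite_keys] that
    proof (induction U rule: finite_induct)
      case empty
      show ?case using I.zero_closed by (simp add: poly_ring_def)
    next
      case (insert m U)
      then have "single m (lookup p m) \<in> edge_ideal G"
        using p by (intro monomial) (auto simp: monomial_span_def)
      then show ?case
        using insert I.a_closed by (simp add: poly_ring_def)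
    qed
    from this[of "keys p"] show "p \<in> edge_ideal G" by (simp add: sum_single_lookup)
  qed
qed

section \<open>Stanley decompositions from interval partitions\<close>

text \<open>A maximum is only meaningful over a finite set of values. A nonzero element rules out the empty
  decomposition, whose minimum over no summands could be anything.\<close>
lemma finite_decomposition_sdepths:
  assumes "finite V" "abelian_monoid M" "x \<in> carrier M" "x \<noteq> \<zero>\<^bsub>M\<^esub>"
  shows "finite {decomposition_sdepth D | D. stanley_decomposition V M D}"
proof (rule finite_subset)
  interpret abelian_monoid M by fact
  show "{decomposition_sdepth D | D. stanley_decomposition V M D} \<subseteq> {..card V}"
  proof clarsimp
    fix D assume D: "stanley_decomposition V M D"
    obtain z where "x = (\<Oplus>\<^bsub>M\<^esub>i \<in> {..<length D}. z i)"
      using D assms(3) unfolding stanley_decomposition_def by blast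
    with assms(4) have "D \<noteq> []" by auto
    then obtain w A where wA: "(w, A) \<in> set D" by (cases "hd D") (metis list.set_sel(1))
    then have "A \<subseteq> V" using D unfolding stanley_decomposition_def by blast
    have "decomposition_sdepth D \<le> card A"
      unfolding decomposition_sdepth_def using wA by (intro Min_le) force+
    also have "\<dots> \<le> card V" using \<open>A \<subseteq> V\<close> assms(1) by (rule card_mono[rotated])
    finally show "decomposition_sdepth D \<le> card V" .
  qed
qed simp

text \<open>Ideals and quotients are treated alike by letting \<open>\<phi>\<close> identify the module with the space spanned
  by the monomials with support in \<open>F\<close>; in the quotient these are the monomials outside the ideal.
  Multiplication needs to be respected only as long as it stays inside that space, which it does
  on each summand \<open>x\<^sup>C K[D]\<close>, since its monomials have support in \<open>[C, D] \<subseteq> F\<close>. Under \<open>\<phi>\<close> the components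
  of an element are its restrictions to the intervals of the partition.\<close>
lemma stanley_decomposition_of_interval_partition:
  fixes M :: "('x, ('x, 'k::field) mpol, 'b) graded_module"
  assumes F: "F \<subseteq> Pow V" "F \<noteq> {}"
    and M: "abelian_monoid M"
    and bij: "bij_betw \<phi> (monomial_span F) (carrier M)"
    and zero: "\<phi> 0 = \<zero>\<^bsub>M\<^esub>"
    and add: "\<And>p q. p \<in> monomial_span F \<Longrightarrow> q \<in> monomial_span F \<Longrightarrow> \<phi> (p + q) = \<phi> p \<oplus>\<^bsub>M\<^esub> \<phi> q"
    and smult: "\<And>p q. p \<in> polys V \<Longrightarrow> q \<in> monomial_span F \<Longrightarrow> p * q \<in> monomial_span F \<Longrightarrow>
      p \<odot>\<^bsub>M\<^esub> \<phi> q = \<phi> (p * q)"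
    and hom: "\<And>m. keys m \<in> F \<Longrightarrow> homogeneous M (\<phi> (single m 1))"
    and part: "interval_partitionable k F"
  shows "\<exists>D. stanley_decomposition V M D \<and> k \<le> decomposition_sdepth D"
proof -
  interpret abelian_monoid M by fact
  from part obtain L where L: "\<And>C A. (C, A) \<in> set L \<Longrightarrow> C \<subseteq> A \<and> finite A \<and> k \<le> card A"
    and cover: "\<And>X. X \<in> F \<longleftrightarrow> (\<exists>i < length L. X \<in> {fst (L ! i)..snd (L ! i)})"
    and uniq: "\<And>X i j. i < length L \<Longrightarrow> j < length L \<Longrightarrow> X \<in> {fst (L ! i)..snd (L ! i)}
       \<Longrightarrow> X \<in> {fst (L ! j)..snd (L ! j)} \<Longrightarrow> i = j"
    by (rule interval_partitionable_list) blast
  let ?x = "\<lambda>C. single (squarefree_exponent C) (1 :: 'k)"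
  let ?int = "\<lambda>i. {fst (L ! i)..snd (L ! i)}"
  define D where "D = map (\<lambda>(C, A). (\<phi> (?x C), A)) L"
  have len: "length D = length L" by (simp add: D_def)
  have \<phi>_carrier: "\<phi> q \<in> carrier M" if "q \<in> monomial_span F" for q
    using bij that by (auto simp: bij_betw_def)
  have inj: "p = q" if "\<phi> p = \<phi> q" "p \<in> monomial_span F" "q \<in> monomial_span F" for p q
    using bij that by (auto simp: bij_betw_def inj_on_def)
  have finsum: "(\<Oplus>\<^bsub>M\<^esub>i \<in> J. \<phi> (q i)) = \<phi> (\<Sum>i \<in> J. q i)"
    if "finite J" "\<And>i. i \<in> J \<Longrightarrow> q i \<in> monomial_span F" for J :: "nat set" and q
    using that
  proof (induction J rule: finite_induct)
    case (insert i J)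
    then have "(\<Oplus>\<^bsub>M\<^esub>i \<in> insert i J. \<phi> (q i)) = \<phi> (q i) \<oplus>\<^bsub>M\<^esub> (\<Oplus>\<^bsub>M\<^esub>i \<in> J. \<phi> (q i))"
      using \<phi>_carrier by (intro finsum_insert) auto
    then show ?case using insert monomial_span_sum[of J q F] by (simp add: add)
  qed (simp add: zero)
  have interval: "C \<in> F" "{C..A} \<subseteq> F" "finite C" if CA: "(C, A) \<in> set L" for C A
  proof -
    obtain i where i: "i < length L" "L ! i = (C, A)" using CA by (auto simp: in_set_conv_nth)
    show sub: "{C..A} \<subseteq> F"
    proof
      fix X assume "X \<in> {C..A}"
      then have "X \<in> ?int i" by (simp add: i(2))
      then show "X \<in> F" using cover i(1) by blast
    qed
    show "finite C" using L[OF CA] finite_subset by blast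
    show "C \<in> F" using L[OF CA] by (intro subsetD[OF sub]) simp
  qed
  have base: "?x C \<in> monomial_span F" if "(C, A) \<in> set L" for C A
    using interval[OF that] by (intro monomial_span_single) (simp add: keys_squarefree_exponent)
  have image: "(\<lambda>p. p * ?x C) ` polys A = monomial_span {C..A}" if "(C, A) \<in> set L" for C A
    using L[OF that] by (intro monomial_times_polys) auto
  have act: "p \<odot>\<^bsub>M\<^esub> \<phi> (?x C) = \<phi> (p * ?x C)" "p * ?x C \<in> monomial_span F"
    if "(C, A) \<in> set L" "p \<in> polys A" for C A p
  proof -
    have "p * ?x C \<in> monomial_span {C..A}" using image[OF that(1)] that(2) by blast
    then show *: "p * ?x C \<in> monomial_span F"
      using monomial_span_mono[OF interval(2)[OF that(1)]] by blast
    have "A \<in> F" using L[OF that(1)] by (intro subsetD[OF interval(2)[OF that(1)]]) simp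
    then have "polys A \<subseteq> polys V" using F(1) by (intro polys_mono) auto
    then show "p \<odot>\<^bsub>M\<^esub> \<phi> (?x C) = \<phi> (p * ?x C)"
      using that(2) by (intro smult base[OF that(1)] *) auto
  qed
  have space: "stanley_space M (fst (D ! i)) (snd (D ! i)) = \<phi> ` monomial_span (?int i)"
    if "i < length L" for i
  proof -
    obtain C A where CA: "L ! i = (C, A)" by (cases "L ! i")
    then have mem: "(C, A) \<in> set L" using that nth_mem by metis
    have "stanley_space M (\<phi> (?x C)) A = (\<lambda>p. \<phi> (p * ?x C)) ` polys A"
      unfolding stanley_space_def using act(1)[OF mem] by (intro image_cong) auto
    also have "\<dots> = \<phi> ` monomial_span {C..A}"
      unfolding image[OF mem, symmetric] by (simp add: image_image)
    finally show ?thesis using that CA by (simp add: D_def)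
  qed
  have span_F: "monomial_span (?int i) \<subseteq> monomial_span F" if "i < length L" for i
    using cover that by (intro monomial_span_mono) blast
  have "stanley_decomposition V M D"
    unfolding stanley_decomposition_def
  proof (intro conjI ballI)
    fix d assume "d \<in> set D"
    then obtain C A where CA: "(C, A) \<in> set L" and d: "d = (\<phi> (?x C), A)"
      by (auto simp: D_def)
    have "keys (squarefree_exponent C) \<in> F"
      using interval[OF CA] by (simp add: keys_squarefree_exponent)
    then have "homogeneous M (\<phi> (?x C))" by (rule hom)
    moreover have "\<phi> (?x C) \<in> carrier M" using base[OF CA] \<phi>_carrier by blast
    moreover have "A \<in> F" using L[OF CA] by (intro subsetD[OF interval(2)[OF CA]]) simp
    then have "A \<subseteq> V" using F(1) by blast
    moreover have "stanley_free M (\<phi> (?x C)) A"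
      unfolding stanley_free_def
    proof (intro ballI impI)
      fix p assume p: "p \<in> polys A" "p \<odot>\<^bsub>M\<^esub> \<phi> (?x C) = \<zero>\<^bsub>M\<^esub>"
      then have "p * ?x C = 0"
        using act[OF CA p(1)] by (intro inj) (simp_all add: zero monomial_span_zero)
      then show "p = 0" by (simp only: times_monomial_eq_0_iff)
    qed
    ultimately show "case d of (w, A) \<Rightarrow> w \<in> carrier M \<and> homogeneous M w \<and> A \<subseteq> V \<and> stanley_free M w A"
      by (simp add: d)
  next
    fix x assume "x \<in> carrier M"
    then obtain q where q: "q \<in> monomial_span F" "x = \<phi> q"
      using bij by (auto simp: bij_betw_def)
    let ?q = "\<lambda>i. restrict_support (?int i) q"
    let ?z = "\<lambda>i \<in> {..<length L}. \<phi> (?q i)"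
    let ?P = "\<Pi>\<^sub>E i \<in> {..<length D}. stanley_space M (fst (D ! i)) (snd (D ! i))"
    have P: "?P = (\<Pi>\<^sub>E i \<in> {..<length L}. \<phi> ` monomial_span (?int i))"
      unfolding len by (rule PiE_cong) (simp add: space)
    (* The supports of distinct parts are disjoint, so a sum determines its components. *)
    have component: "restrict_support (?int i) (\<Sum>j < length L. r j) = r i"
      if r: "\<And>j. j < length L \<Longrightarrow> r j \<in> monomial_span (?int j)" and i: "i < length L"
      for r :: "nat \<Rightarrow> ('x, 'k) mpol" and i
    proof (rule poly_mapping_eqI)
      fix m
      have other: "lookup (r j) m = 0" if "keys m \<in> ?int i" "j < length L" "j \<noteq> i" for j
        using r[OF that(2)] uniq[OF that(2) i _ that(1)] that(3)
        unfolding monomial_span_iff by blast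
      have "(\<Sum>j < length L. lookup (r j) m) = lookup (r i) m" if "keys m \<in> ?int i"
        using other[OF that] i by (subst sum.remove[of _ i]) auto
      moreover have "lookup (r i) m = 0" if "keys m \<notin> ?int i"
        using r[OF i] that unfolding monomial_span_iff by blast
      ultimately show "lookup (restrict_support (?int i) (\<Sum>j < length L. r j)) m = lookup (r i) m"
        unfolding lookup_restrict_support lookup_sum by simp
    qed
    have sum_q: "(\<Sum>i < length L. ?q i) = q"
    proof (rule poly_mapping_eqI)
      fix m
      show "lookup (\<Sum>i < length L. ?q i) m = lookup q m"
      proof (cases "keys m \<in> F")
        case True
        then obtain i where i: "i < length L" "keys m \<in> ?int i" using cover by blast
        have "lookup (?q j) m = 0" if "j < length L" "j \<noteq> i" for j
          using uniq[OF that(1) i(1) _ i(2)] that(2) by (auto simp: lookup_restrict_support)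
        then have "(\<Sum>j < length L. lookup (?q j) m) = lookup (?q i) m"
          using i(1) by (subst sum.remove[of _ i]) auto
        then show ?thesis using i(2) unfolding lookup_sum lookup_restrict_support by simp
      next
        case False
        then have "lookup q m = 0" using q(1) unfolding monomial_span_iff by blast
        then have "lookup (?q i) m = 0" for i by (simp add: lookup_restrict_support)
        with \<open>lookup q m = 0\<close> show ?thesis unfolding lookup_sum by simp
      qed
    qed
    have expand: "(\<Oplus>\<^bsub>M\<^esub>i \<in> {..<length D}. z i) = \<phi> (\<Sum>i < length L. r i)"
      if "\<And>i. i < length L \<Longrightarrow> z i = \<phi> (r i)" "\<And>i. i < length L \<Longrightarrow> r i \<in> monomial_span (?int i)" for z r
    proof -
      have r: "r i \<in> monomial_span F" if "i < length L" for i
        using span_F that \<open>\<And>i. i < length L \<Longrightarrow> r i \<in> monomial_span (?int i)\<close> by blast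
      have "(\<Oplus>\<^bsub>M\<^esub>i \<in> {..<length D}. z i) = (\<Oplus>\<^bsub>M\<^esub>i \<in> {..<length L}. \<phi> (r i))"
        unfolding len using r that(1) \<phi>_carrier by (intro finsum_cong') auto
      then show ?thesis using finsum[of "{..<length L}" r] r by simp
    qed
    show "\<exists>!z. z \<in> ?P \<and> x = (\<Oplus>\<^bsub>M\<^esub>i \<in> {..<length D}. z i)"
    proof (rule ex1I[of _ ?z])
      have "?z \<in> ?P" unfolding P using restrict_support_in by (intro restrict_PiE_iff[THEN iffD2]) blast
      moreover have "(\<Oplus>\<^bsub>M\<^esub>i \<in> {..<length D}. ?z i) = \<phi> (\<Sum>i < length L. ?q i)"
        by (rule expand) (simp, rule restrict_support_in)
      ultimately show "?z \<in> ?P \<and> x = (\<Oplus>\<^bsub>M\<^esub>i \<in> {..<length D}. ?z i)" unfolding sum_q by (simp add: q(2))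
    next
      fix z assume z: "z \<in> ?P \<and> x = (\<Oplus>\<^bsub>M\<^esub>i \<in> {..<length D}. z i)"
      have "\<exists>r. r \<in> monomial_span (?int i) \<and> z i = \<phi> r" if "i < length L" for i
        using z that unfolding P by (auto dest: PiE_mem)
      then obtain r where r: "\<And>i. i < length L \<Longrightarrow> r i \<in> monomial_span (?int i)"
        "\<And>i. i < length L \<Longrightarrow> z i = \<phi> (r i)" by metis
      have "\<phi> (\<Sum>i < length L. r i) = \<phi> q" using z expand[of z r] r q(2) by simp
      then have "(\<Sum>i < length L. r i) = q"
        using r(1) span_F q(1) by (intro inj monomial_span_sum) auto
      then have "z i = \<phi> (?q i)" if "i < length L" for i
        using component[of r i] r that by simp
      moreover have "z i = undefined" if "\<not> i < length L" for i
        using z that unfolding P by (auto simp: PiE_def extensional_def)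
      ultimately show "z = ?z" by (auto simp: restrict_def)
    qed
  qed
  moreover have "k \<le> decomposition_sdepth D"
  proof -
    have "L \<noteq> []" using F(2) cover by fastforce
    then show ?thesis unfolding decomposition_sdepth_def D_def using L
      by (intro Min.boundedI) auto
  qed
  ultimately show ?thesis by blast
qed

lemma sdepth_ge:
  assumes "finite V" "abelian_monoid M" "x \<in> carrier M" "x \<noteq> \<zero>\<^bsub>M\<^esub>"
    and "stanley_decomposition V M D" "k \<le> decomposition_sdepth D"
  shows "k \<le> sdepth V M"
proof -
  have "decomposition_sdepth D \<le> sdepth V M"
    unfolding sdepth_def using finite_decomposition_sdepths[OF assms(1-4)] assms(5)
    by (intro Max_ge) auto
  then show ?thesis using assms(6) by simp
qed

lemma sdepth_ideal_module_ge:
  fixes I :: "('x, 'k::field) mpol set"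
  assumes V: "finite V" and F: "F \<subseteq> Pow V" "F \<noteq> {}"
    and I: "ideal I (poly_ring V)" "I = monomial_span F"
    and part: "interval_partitionable k F"
  shows "k \<le> sdepth V (ideal_module V I)"
proof -
  let ?M = "ideal_module V I"
  interpret Module.module "poly_ring V" ?M by (rule module_ideal_module[OF I(1)])
  obtain X where X: "X \<in> F" using F(2) by blast
  then have "finite X" using F(1) V by (auto intro: finite_subset)
  have sub: "monomial_span F \<subseteq> (polys V :: ('x, 'k) mpol set)"
    unfolding polys_eq_monomial_span using F(1) by (rule monomial_span_mono)
  have "\<exists>D. stanley_decomposition V ?M D \<and> k \<le> decomposition_sdepth D"
  proof (rule stanley_decomposition_of_interval_partition[OF F M.abelian_monoid_axioms _ _ _ _ _ part])
    show "bij_betw (\<lambda>p. p) (monomial_span F) (carrier ?M)"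
      by (simp add: ideal_module_def I(2) bij_betw_def)
  next
    fix m :: "'x \<Rightarrow>\<^sub>0 nat" assume m: "keys m \<in> F"
    then have "single m 1 \<in> (monomial_span F :: ('x, 'k) mpol set)" by (rule monomial_span_single)
    with sub show "homogeneous ?M (single m 1)"
      unfolding homogeneous_def ideal_module_def poly_comp_def I(2)
      by (intro exI[of _ "\<lambda>v. int (lookup m v)"]) auto
  qed (simp_all add: ideal_module_def)
  moreover have "single (squarefree_exponent X) 1 \<in> carrier ?M"
    using X \<open>finite X\<close>
    by (auto simp: ideal_module_def I(2) keys_squarefree_exponent intro!: monomial_span_single)
  moreover have "single (squarefree_exponent X) 1 \<noteq> \<zero>\<^bsub>?M\<^esub>"
  proof
    assume "single (squarefree_exponent X) 1 = \<zero>\<^bsub>?M\<^esub>"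
    then have "lookup (single (squarefree_exponent X) (1 :: 'k)) (squarefree_exponent X) = 0"
      by (simp add: ideal_module_def)
    then show False by simp
  qed
  ultimately show ?thesis using sdepth_ge[OF V M.abelian_monoid_axioms] by blast
qed

section \<open>Quotients by squarefree monomial ideals\<close>

text \<open>These facts reduce all computations in the quotient module to polynomials.\<close>
lemma quotient_module_coset:
  fixes I :: "('x, 'k::field) mpol set"
  assumes "ideal I (poly_ring V)"
  defines "coset \<equiv> (\<lambda>p. I +>\<^bsub>poly_ring V\<^esub> p)" and "M \<equiv> quotient_module V I"
  shows carrier_quotient_module: "carrier M = coset ` polys V"
    and coset_zero: "coset 0 = \<zero>\<^bsub>M\<^esub>"
    and coset_add: "p \<in> polys V \<Longrightarrow> q \<in> polys V \<Longrightarrow> coset (p + q) = coset p \<oplus>\<^bsub>M\<^esub> coset q"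
    and coset_smult: "p \<in> polys V \<Longrightarrow> q \<in> polys V \<Longrightarrow> p \<odot>\<^bsub>M\<^esub> coset q = coset (p * q)"
    and coset_eq_iff: "p \<in> polys V \<Longrightarrow> q \<in> polys V \<Longrightarrow> coset p = coset q \<longleftrightarrow> p - q \<in> I"
proof -
  interpret ideal I "poly_ring V" by fact
  interpret h: ring_hom_ring "poly_ring V" "poly_ring V Quot I" coset
    unfolding coset_def by (rule rcos_ring_hom_ring)
  note [simp] = M_def quotient_module_def Let_def
  have S: "carrier (poly_ring V) = (polys V :: ('x, 'k) mpol set)" by (simp add: poly_ring_def)
  show "carrier M = coset ` polys V"
    by (auto simp add: FactRing_def A_RCOSETS_def' S coset_def)
  show "coset 0 = \<zero>\<^bsub>M\<^esub>" using h.hom_zero by (simp add: poly_ring_def)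
  show "coset (p + q) = coset p \<oplus>\<^bsub>M\<^esub> coset q" if "p \<in> polys V" "q \<in> polys V" for p q
    using h.hom_add[of p q] that by (simp add: poly_ring_def)
  show "p \<odot>\<^bsub>M\<^esub> coset q = coset (p * q)" if "p \<in> polys V" "q \<in> polys V" for p q
    using h.hom_mult[of p q] that by (simp add: poly_ring_def coset_def)
  show "coset p = coset q \<longleftrightarrow> p - q \<in> I" if "p \<in> polys V" "q \<in> polys V" for p q
  proof -
    have "\<ominus>\<^bsub>poly_ring V\<^esub> q = - q"
      by (rule minus_equality) (use that in \<open>simp_all add: poly_ring_def polys_uminus\<close>)
    then have "p \<ominus>\<^bsub>poly_ring V\<^esub> q = p - q" by (simp add: a_minus_def poly_ring_def)
    then show ?thesis
      using quotient_eq_iff_same_a_r_cos[OF assms(1), of p q] that by (simp add: S coset_def)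
  qed
qed

lemma abelian_monoid_quotient_module:
  assumes "ideal I (poly_ring V)"
  shows "abelian_monoid (quotient_module V I)"
proof -
  interpret Module.module "poly_ring V" "quotient_module V I" by (rule module_quotient_module[OF assms])
  show ?thesis by (rule M.abelian_monoid_axioms)
qed

text \<open>Dropping all monomials that lie in the ideal gives a unique normal form of each coset.\<close>
lemma bij_betw_coset_monomial_span:
  fixes I :: "('x, 'k::field) mpol set"
  assumes I: "ideal I (poly_ring V)" "I = monomial_span F"
  shows "bij_betw (\<lambda>p. I +>\<^bsub>poly_ring V\<^esub> p) (monomial_span (Pow V - F)) (carrier (quotient_module V I))"
  unfolding bij_betw_def
proof
  let ?coset = "\<lambda>p. I +>\<^bsub>poly_ring V\<^esub> p" and ?N = "monomial_span (Pow V - F) :: ('x, 'k) mpol set"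
  have sub: "?N \<subseteq> polys V" unfolding polys_eq_monomial_span by (rule monomial_span_mono) blast
  show "inj_on ?coset ?N"
  proof (rule inj_onI)
    fix p q assume pq: "p \<in> ?N" "q \<in> ?N" "?coset p = ?coset q"
    then have "p - q \<in> I" using coset_eq_iff[OF I(1), of p q] sub by blast
    moreover have "p - q \<in> ?N" using pq by (intro monomial_span_diff)
    ultimately have "lookup (p - q) m = 0" for m
      unfolding I(2) monomial_span_iff by blast
    then show "p = q" by (intro poly_mapping_eqI) (simp add: lookup_minus)
  qed
  have "?coset p \<in> ?coset ` ?N" if p: "p \<in> polys V" for p
  proof (rule image_eqI)
    let ?r = "restrict_support (Pow V - F) p"
    show "?r \<in> ?N" by (rule restrict_support_in)
    moreover have "p - ?r \<in> I"
      using p unfolding I(2) polys_eq_monomial_span monomial_span_iff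
      by (auto simp: lookup_minus lookup_restrict_support)
    ultimately show "?coset p = ?coset ?r" using coset_eq_iff[OF I(1) p] sub by blast
  qed
  then show "?coset ` ?N = carrier (quotient_module V I)"
    unfolding carrier_quotient_module[OF I(1)] using sub by blast
qed

lemma stanley_decomposition_quotient_module:
  fixes I :: "('x, 'k::field) mpol set"
  assumes I: "ideal I (poly_ring V)" "I = monomial_span F" "\<not> Pow V \<subseteq> F"
    and part: "interval_partitionable k (Pow V - F)"
  shows "\<exists>D. stanley_decomposition V (quotient_module V I) D \<and> k \<le> decomposition_sdepth D"
proof -
  let ?M = "quotient_module V I" and ?coset = "\<lambda>p. I +>\<^bsub>poly_ring V\<^esub> p"
  have sub: "monomial_span (Pow V - F) \<subseteq> (polys V :: ('x, 'k) mpol set)"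
    unfolding polys_eq_monomial_span by (rule monomial_span_mono) blast
  show ?thesis
  proof (rule stanley_decomposition_of_interval_partition[where F = "Pow V - F" and \<phi> = ?coset, OF _ _
        abelian_monoid_quotient_module[OF I(1)] bij_betw_coset_monomial_span[OF I(1,2)] coset_zero[OF I(1)]
        _ _ _ part])
    fix m :: "'x \<Rightarrow>\<^sub>0 nat" assume m: "keys m \<in> Pow V - F"
    then have "single m 1 \<in> (poly_comp V (\<lambda>v. int (lookup m v)) :: ('x, 'k) mpol set)"
      by (auto simp: poly_comp_def polys_def)
    then show "homogeneous ?M (?coset (single m 1))"
      by (auto simp: homogeneous_def quotient_module_def Let_def)
  next
    fix p q :: "('x, 'k) mpol"
    assume "p \<in> monomial_span (Pow V - F)" "q \<in> monomial_span (Pow V - F)"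
    with sub have "p \<in> polys V" "q \<in> polys V" by blast+
    then show "?coset (p + q) = ?coset p \<oplus>\<^bsub>?M\<^esub> ?coset q" by (rule coset_add[OF I(1)])
  next
    fix p q :: "('x, 'k) mpol"
    assume "p \<in> polys V" "q \<in> monomial_span (Pow V - F)"
    with sub have "p \<in> polys V" "q \<in> polys V" by blast+
    then show "p \<odot>\<^bsub>?M\<^esub> ?coset q = ?coset (p * q)" by (rule coset_smult[OF I(1)])
  qed (use I(3) in blast)+
qed

text \<open>The class of \<open>x\<^sup>T\<close> is a sum of elements of the summands, and the coefficient at \<open>x\<^sup>T\<close> is
  well-defined on cosets because \<open>x\<^sup>T\<close> is not in the ideal. Hence there are a summand \<open>w K[A]\<close>, where \<open>w\<close>
  is up to a scalar the class of a monomial \<open>x\<^sup>u\<close>, and \<open>x\<^sup>m\<close> in \<open>K[A]\<close> with \<open>x\<^sup>m x\<^sup>u = x\<^sup>T\<close>. For a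
  variable \<open>v \<in> A\<close> outside \<open>T\<close>, the element \<open>v x\<^sup>m\<close> of \<open>K[A]\<close> would annihilate \<open>w\<close>, since its product
  with \<open>x\<^sup>u\<close> has support \<open>T \<union> {v}\<close>. Freeness therefore gives \<open>A \<subseteq> T\<close>.\<close>
lemma decomposition_sdepth_quotient_le:
  fixes I :: "('x, 'k::field) mpol set"
  assumes V: "finite V" and I: "ideal I (poly_ring V)" "I = monomial_span F"
    and T: "T \<subseteq> V" "T \<notin> F" "\<And>v. v \<in> V - T \<Longrightarrow> insert v T \<in> F"
    and D: "stanley_decomposition V (quotient_module V I) D"
  shows "decomposition_sdepth D \<le> card T"
proof -
  let ?M = "quotient_module V I" and ?coset = "\<lambda>p. I +>\<^bsub>poly_ring V\<^esub> p"
  let ?e = "squarefree_exponent T"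
  interpret abelian_monoid ?M by (rule abelian_monoid_quotient_module[OF I(1)])
  have "finite T" using T(1) V by (rule finite_subset)
  have e: "single ?e 1 \<in> (polys V :: ('x, 'k) mpol set)"
    using T(1) \<open>finite T\<close> by (intro polys_single) (simp add: keys_squarefree_exponent)
  have "?coset (single ?e 1) \<in> carrier ?M"
    unfolding carrier_quotient_module[OF I(1)] using e by blast
  from ex1_implies_ex[OF D[unfolded stanley_decomposition_def, THEN conjunct2, rule_format, OF this]]
  obtain z where
    z: "z \<in> (\<Pi>\<^sub>E i \<in> {..<length D}. stanley_space ?M (fst (D ! i)) (snd (D ! i)))"
    and z_sum: "?coset (single ?e 1) = (\<Oplus>\<^bsub>?M\<^esub>i \<in> {..<length D}. z i)"
    by blast
  have "\<exists>p q a. snd (D ! i) \<subseteq> V \<and> p \<in> polys (snd (D ! i)) \<and> q \<in> poly_comp V a \<and>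
      fst (D ! i) = ?coset q \<and> z i = ?coset (p * q)" if i: "i < length D" for i
  proof -
    obtain w A where wA: "D ! i = (w, A)" by (cases "D ! i")
    have "(w, A) \<in> set D" using i wA nth_mem by metis
    then have w: "homogeneous ?M w" "A \<subseteq> V" using D unfolding stanley_decomposition_def by blast+
    then obtain a q where q: "q \<in> poly_comp V a" "w = ?coset q"
      by (auto simp: homogeneous_def quotient_module_def Let_def)
    have "z i \<in> stanley_space ?M w A" using z i wA by (auto dest: PiE_mem)
    then obtain p where p: "p \<in> polys A" "z i = p \<odot>\<^bsub>?M\<^esub> w" by (auto simp: stanley_space_def)
    have "p \<in> polys V" "q \<in> polys V"
      using p(1) polys_mono[OF w(2)] q(1) by (auto simp: poly_comp_def)
    then have "z i = ?coset (p * q)" unfolding p(2) q(2) by (rule coset_smult[OF I(1)])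
    then show ?thesis using wA w(2) p(1) q by auto
  qed
  then obtain p q a where
    A: "\<And>i. i < length D \<Longrightarrow> snd (D ! i) \<subseteq> V" and
    p: "\<And>i. i < length D \<Longrightarrow> p i \<in> polys (snd (D ! i))" and
    q: "\<And>i. i < length D \<Longrightarrow> q i \<in> poly_comp V (a i)" and
    w: "\<And>i. i < length D \<Longrightarrow> fst (D ! i) = ?coset (q i)" and
    z_eq: "\<And>i. i < length D \<Longrightarrow> z i = ?coset (p i * q i)" by metis
  have pq: "p i * q i \<in> polys V" if "i < length D" for i
    using p[OF that] q[OF that] polys_mono[OF A[OF that]] by (intro polys_mult) (auto simp: poly_comp_def)
  have sum: "(\<Sum>i \<in> J. p i * q i) \<in> polys V \<and> (\<Oplus>\<^bsub>?M\<^esub>i \<in> J. z i) = ?coset (\<Sum>i \<in> J. p i * q i)"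
    if "finite J" "J \<subseteq> {..<length D}" for J
    using that
  proof (induction J rule: finite_induct)
    case empty
    show ?case using coset_zero[OF I(1)] by (simp add: polys_0)
  next
    case (insert i J)
    have carr: "z j \<in> carrier ?M" if "j < length D" for j
      unfolding carrier_quotient_module[OF I(1)] z_eq[OF that] using pq[OF that] by blast
    have "(\<Oplus>\<^bsub>?M\<^esub>i \<in> insert i J. z i) = z i \<oplus>\<^bsub>?M\<^esub> (\<Oplus>\<^bsub>?M\<^esub>i \<in> J. z i)"
      using insert.hyps insert.prems carr by (intro finsum_insert) auto
    then show ?case
      using insert pq[of i] z_eq[of i] coset_add[OF I(1), of "p i * q i" "\<Sum>i \<in> J. p i * q i"]
      by (simp add: polys_add)
  qed
  have "single ?e 1 - (\<Sum>i < length D. p i * q i) \<in> I"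
    using sum[of "{..<length D}"] z_sum coset_eq_iff[OF I(1) e] by simp
  then have "lookup (single ?e 1 - (\<Sum>i < length D. p i * q i)) ?e = 0"
    using T(2) \<open>finite T\<close> unfolding I(2) monomial_span_iff by (simp add: keys_squarefree_exponent)
  then have "(\<Sum>i < length D. lookup (p i * q i) ?e) \<noteq> 0"
    by (simp add: lookup_minus lookup_sum)
  then obtain i where i: "i < length D" "lookup (p i * q i) ?e \<noteq> 0"
    by (metis (no_types, lifting) lessThan_iff sum.neutral)
  then have "?e \<in> keys (p i * q i)" by (simp add: in_keys_iff)
  then obtain m u where m: "m \<in> keys (p i)" and u: "u \<in> keys (q i)" and e_eq: "?e = m + u"
    using keys_mult[of "p i" "q i"] by blast
  (* The generator of the summand is homogeneous, so u is its only monomial. *)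
  have keys_q: "u' = u" if "u' \<in> keys (q i)" for u'
  proof (rule poly_mapping_eqI)
    fix v
    have "int (lookup u'' v) = a i v" if "u'' \<in> keys (q i)" for u''
      using q[OF i(1)] that by (simp add: poly_comp_def)
    from this[OF that] this[OF u] show "lookup u' v = lookup u v" by simp
  qed
  have "snd (D ! i) \<subseteq> T"
  proof
    fix v assume v: "v \<in> snd (D ! i)"
    show "v \<in> T"
    proof (rule ccontr)
      assume "v \<notin> T"
      then have insert: "insert v T \<in> F" using v A[OF i(1)] T(3) by blast
      let ?m = "single (m + single v 1) (1 :: 'k)"
      have "keys m \<subseteq> snd (D ! i)" using m p[OF i(1)] by (auto simp: polys_def)
      then have m_polys: "?m \<in> polys (snd (D ! i))"
        using v by (intro polys_single) (auto simp: keys_add_nat)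
      have "keys k \<in> F" if "k \<in> keys (?m * q i)" for k
      proof -
        obtain m' u' where k: "m' \<in> keys ?m" "u' \<in> keys (q i)" "k = m' + u'"
          using keys_mult[of ?m "q i"] \<open>k \<in> keys (?m * q i)\<close> by blast
        then have "k = ?e + single v 1"
          using keys_q[OF k(2)] by (simp add: e_eq add_ac)
        then have "keys k = insert v T"
          using \<open>finite T\<close> by (simp add: keys_add_nat keys_squarefree_exponent)
        then show ?thesis using insert by simp
      qed
      then have "?m * q i \<in> I" unfolding I(2) monomial_span_def by blast
      moreover have qV: "q i \<in> polys V" "?m \<in> polys V"
        using q[OF i(1)] m_polys polys_mono[OF A[OF i(1)]] by (auto simp: poly_comp_def)
      ultimately have "?coset (?m * q i) = \<zero>\<^bsub>?M\<^esub>"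
        using coset_eq_iff[OF I(1) polys_mult[OF qV(2,1)] polys_0] coset_zero[OF I(1)] by simp
      then have "?m \<odot>\<^bsub>?M\<^esub> fst (D ! i) = \<zero>\<^bsub>?M\<^esub>"
        unfolding w[OF i(1)] coset_smult[OF I(1) qV(2,1)] .
      moreover have "stanley_free ?M (fst (D ! i)) (snd (D ! i))"
        using D nth_mem[OF i(1)] unfolding stanley_decomposition_def by (auto simp: case_prod_beta)
      ultimately have "?m = 0" using m_polys unfolding stanley_free_def by blast
      then have "lookup ?m (m + single v 1) = 0" by simp
      then show False by simp
    qed
  qed
  then have "card (snd (D ! i)) \<le> card T" using \<open>finite T\<close> by (intro card_mono)
  moreover have "decomposition_sdepth D \<le> card (snd (D ! i))"
    unfolding decomposition_sdepth_def using nth_mem[OF i(1)]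
    by (intro Min_le) (auto simp: case_prod_beta)
  ultimately show ?thesis by simp
qed

lemma sdepth_quotient_module_eq:
  fixes I :: "('x, 'k::field) mpol set"
  assumes V: "finite V" and I: "ideal I (poly_ring V)" "I = monomial_span F"
    and T: "T \<subseteq> V" "T \<notin> F" "\<And>v. v \<in> V - T \<Longrightarrow> insert v T \<in> F"
    and part: "interval_partitionable k (Pow V - F)" and k: "k = card T"
  shows "sdepth V (quotient_module V I) = k"
proof -
  let ?M = "quotient_module V I" and ?coset = "\<lambda>p. I +>\<^bsub>poly_ring V\<^esub> p"
  let ?e = "squarefree_exponent T"
  have "finite T" using T(1) V by (rule finite_subset)
  have e: "single ?e 1 \<in> (polys V :: ('x, 'k) mpol set)"
    using T(1) \<open>finite T\<close> by (intro polys_single) (simp add: keys_squarefree_exponent)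
  have "single ?e 1 \<notin> I"
    using T(2) \<open>finite T\<close> unfolding I(2) monomial_span_def by (simp add: keys_squarefree_exponent)
  then have "?coset (single ?e 1) \<noteq> \<zero>\<^bsub>?M\<^esub>"
    using coset_eq_iff[OF I(1) e polys_0] coset_zero[OF I(1)] by simp
  moreover have "?coset (single ?e 1) \<in> carrier ?M"
    unfolding carrier_quotient_module[OF I(1)] using e by blast
  moreover obtain D where D: "stanley_decomposition V ?M D" "k \<le> decomposition_sdepth D"
    using stanley_decomposition_quotient_module[OF I _ part] T(1,2) by blast
  ultimately have fin: "finite {decomposition_sdepth D | D. stanley_decomposition V ?M D}"
    and "k \<le> sdepth V ?M"
    using finite_decomposition_sdepths[OF V abelian_monoid_quotient_module[OF I(1)]]
      sdepth_ge[OF V abelian_monoid_quotient_module[OF I(1)]] by blast+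
  moreover have "sdepth V ?M \<le> k"
    unfolding sdepth_def k
    by (rule Max.boundedI[OF fin]) (use D(1) decomposition_sdepth_quotient_le[OF V I T] in blast)+
  ultimately show ?thesis by simp
qed

section \<open>Interval partitions for the grid with two rows\<close>

text \<open>The independence complex of the grid with \<open>n\<close> columns and two rows.\<close>
abbreviation (input) grid_independent_sets :: "nat \<Rightarrow> (nat \<times> nat) set set" (\<open>\<Delta>\<close>)
  where "\<Delta> n \<equiv> independent_sets (strong_grid n 2)"

lemma pverts_strong_grid_2: "pverts (strong_grid n 2) = {1..n} \<times> {1, 2}"
  by (auto simp: strong_product_def path_graph_def)

lemma parcs_strong_grid_2:
  "parcs (strong_grid n 2) = {(p, q). p \<in> {1..n} \<times> {1, 2} \<and> q \<in> {1..n} \<times> {1, 2} \<and>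
     p \<noteq> q \<and> fst p \<le> fst q + 1 \<and> fst q \<le> fst p + 1}"
  by (auto simp: strong_product_def path_graph_def)

lemma dependent_sets_grid_iff:
  "X \<in> dependent_sets (strong_grid n 2) \<longleftrightarrow> X \<subseteq> {1..n} \<times> {1, 2} \<and>
     (\<exists>p \<in> X. \<exists>q \<in> X. p \<noteq> q \<and> fst p \<le> fst q + 1 \<and> fst q \<le> fst p + 1)"
  unfolding dependent_sets_def pverts_strong_grid_2 parcs_strong_grid_2 by blast

lemma independent_sets_grid_iff:
  "X \<in> \<Delta> n \<longleftrightarrow> X \<subseteq> {1..n} \<times> {1, 2} \<and>
     (\<forall>p \<in> X. \<forall>q \<in> X. p \<noteq> q \<longrightarrow> fst p + 1 < fst q \<or> fst q + 1 < fst p)"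
  unfolding independent_sets_def Diff_iff dependent_sets_grid_iff
  by (auto simp: pverts_strong_grid_2 not_le simp del: One_nat_def)

lemma independent_subset:
  assumes "X \<in> \<Delta> m" "Y \<subseteq> X" "\<And>q. q \<in> Y \<Longrightarrow> fst q \<le> n"
  shows "Y \<in> \<Delta> n"
proof -
  have "Y \<subseteq> {1..n} \<times> {1, 2}"
  proof
    fix q assume "q \<in> Y"
    then have "q \<in> {1..m} \<times> {1, 2}" "fst q \<le> n"
      using assms unfolding independent_sets_grid_iff by blast+
    then show "q \<in> {1..n} \<times> {1, 2}" by (cases q) simp
  qed
  then show ?thesis using assms(1,2) unfolding independent_sets_grid_iff by blast
qed

lemma independent_insert:
  assumes "X \<in> \<Delta> n" "n \<le> m" "i \<in> {1..m}" "c \<in> {1, 2}"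
    and "\<And>q. q \<in> X \<Longrightarrow> fst q + 1 < i"
  shows "insert (i, c) X \<in> \<Delta> m"
proof -
  have "X \<subseteq> {1..m} \<times> {1, 2}"
    using assms(1,2) unfolding independent_sets_grid_iff by (auto intro: le_trans)
  moreover have "p = (i, c) \<or> p \<in> X" if "p \<in> insert (i, c) X" for p
    using that by blast
  ultimately show ?thesis
    using assms unfolding independent_sets_grid_iff
    by (smt (verit) SigmaI fst_conv insert_iff insert_subset)
qed

text \<open>The neighbours of \<open>(i, c)\<close> fill the columns from \<open>i - 1\<close> to \<open>i + 1\<close>, and no column further right
  is occupied.\<close>
lemma independent_remove:
  assumes "X \<in> \<Delta> m" "(i, c) \<in> X"
    and "\<And>q. q \<in> X \<Longrightarrow> fst q \<le> i + 1"
  shows "X - {(i, c)} \<in> \<Delta> (i - 2)"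
proof (rule independent_subset[OF assms(1)])
  fix q assume "q \<in> X - {(i, c)}"
  then have "fst q + 1 < i \<or> i + 1 < fst q"
    using assms(1,2) unfolding independent_sets_grid_iff by (metis DiffE fst_conv insertI1)
  then show "fst q \<le> i - 2"
    using assms(3) \<open>q \<in> X - {(i, c)}\<close> by fastforce
qed auto

lemma independent_bounds:
  "X \<in> \<Delta> m \<Longrightarrow> q \<in> X \<Longrightarrow> 1 \<le> fst q \<and> fst q \<le> m \<and> (snd q = 1 \<or> snd q = 2)"
  unfolding independent_sets_grid_iff by fastforce

lemma disjoint_Union_independent:
  assumes "\<And>q. q \<in> D \<Longrightarrow> m < fst q"
  shows "D \<inter> \<Union>(\<Delta> m) = {}"
  using assms independent_bounds by (fastforce dest: leD)

lemma independent_of_remove: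
  assumes "X - {(i, c)} \<in> \<Delta> (i - 2)" "i \<in> {1..m}" "c \<in> {1, 2}"
  shows "X \<in> \<Delta> m"
proof -
  have "fst q + 1 < i" if "q \<in> X - {(i, c)}" for q
    using independent_bounds[OF assms(1) that] by linarith
  then have *: "insert (i, c) (X - {(i, c)}) \<in> \<Delta> m"
    using assms by (intro independent_insert[OF assms(1)]) auto
  show ?thesis by (rule independent_subset[OF *]) (use independent_bounds[OF *] in auto)
qed

text \<open>The cases are whether column \<open>n + 1\<close> is occupied. If it is, then columns \<open>n\<close> and \<open>n + 2\<close> are empty,
  and the rest lives in the first \<open>n - 1\<close> columns. Otherwise column \<open>n + 2\<close> does not interact with
  the first \<open>n\<close> columns; its three possible states are grouped into an interval with upper end
  \<open>{(n + 2, 1)}\<close> and the single set \<open>{(n + 2, 2)}\<close>, so that both upper ends are nonempty.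
  The truncation of \<open>n - 1\<close> for \<open>n = 0\<close> is correct, as column \<open>0\<close> does not exist.\<close>
lemma independent_sets_grid_rec:
  "\<Delta> (n + 2) =
     (\<Union>c \<in> {1, 2}. {X. {(n + 1, c)} \<subseteq> X \<and> X - {(n + 1, c)} \<in> \<Delta> (n - 1)}) \<union>
     (\<Union>c \<in> {1, 2}. {X. (if c = 1 then {} else {(n + 2, c)}) \<subseteq> X \<and>
        X - {(n + 2, c)} \<in> \<Delta> n})" (is "_ = ?A \<union> ?B")
proof (intro equalityI subsetI)
  fix X assume X: "X \<in> \<Delta> (n + 2)"
  show "X \<in> ?A \<union> ?B"
  proof (cases "\<exists>c. (n + 1, c) \<in> X")
    case True
    then obtain c where c: "(n + 1, c) \<in> X" by blast
    then have "c \<in> {1, 2}" using X unfolding independent_sets_grid_iff by blast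
    moreover have "X - {(n + 1, c)} \<in> \<Delta> (n - 1)"
      using independent_remove[OF X c] independent_bounds[OF X] by fastforce
    ultimately show ?thesis using c by blast
  next
    case False
    have le: "fst q \<le> n" if "q \<in> X" "fst q \<noteq> n + 2" for q
    proof -
      have "fst q \<noteq> n + 1" using False that by (metis prod.collapse)
      then show ?thesis using independent_bounds[OF X that(1)] that(2) by linarith
    qed
    show ?thesis
    proof (cases "(n + 2, 2) \<in> X")
      case True
      have "X - {(n + 2, 2)} \<in> \<Delta> n"
        using independent_remove[OF X True] independent_bounds[OF X] by fastforce
      then show ?thesis using True by auto
    next
      case F2: False
      have "X - {(n + 2, 1)} \<in> \<Delta> n"
      proof (rule independent_subset[OF X])
        fix q assume q: "q \<in> X - {(n + 2, 1)}"
        then have "snd q = 1 \<or> snd q = 2" using independent_bounds[OF X] by auto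
        then have "fst q \<noteq> n + 2" using q F2 by (metis DiffE prod.collapse singletonI)
        then show "fst q \<le> n" using le q by blast
      qed auto
      then show ?thesis by auto
    qed
  qed
next
  fix X assume "X \<in> ?A \<union> ?B"
  then show "X \<in> \<Delta> (n + 2)"
  proof
    assume "X \<in> ?A"
    then obtain c where "c \<in> {1, 2}" "X - {(n + 1, c)} \<in> \<Delta> (n - 1)" by blast
    then show ?thesis by (intro independent_of_remove[of X "n + 1" c]) auto
  next
    assume "X \<in> ?B"
    then obtain c where "c \<in> {1, 2}" "X - {(n + 2, c)} \<in> \<Delta> n" by blast
    then show ?thesis by (intro independent_of_remove[of X "n + 2" c]) auto
  qed
qed

text \<open>Each case of the recursion adds one vertex and removes at most three columns, which raises the
  bound by one.\<close>
lemma interval_partitionable_independent_sets: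
  "interval_partitionable ((n + 2) div 3) (\<Delta> n)"
proof (induction n rule: less_induct)
  case (less n)
  consider "n = 0" | "n = 1" | m where "n = m + 2"
    by (metis One_nat_def add_2_eq_Suc' not0_implies_Suc)
  then show ?case
  proof cases
    case 1
    have "\<Delta> 0 = {{}..{}}" by (auto simp: independent_sets_grid_iff)
    then show ?thesis using 1 interval_partitionable_interval[of "{}" "{}" 0] by simp
  next
    case 2
    have "\<Delta> 1 = {{}..{(1, 1)}} \<union> {{(1, 2)}..{(1, 2)}}"
    proof (intro equalityI subsetI)
      fix X assume X: "X \<in> \<Delta> 1"
      then have "X \<subseteq> {(1, 1), (1, 2)}"
        by (auto simp: independent_sets_grid_iff)
      moreover have "\<not> ((1, 1) \<in> X \<and> (1, 2) \<in> X)"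
        using X unfolding independent_sets_grid_iff by force
      ultimately show "X \<in> {{}..{(1, 1)}} \<union> {{(1, 2)}..{(1, 2)}}" by auto
    qed (auto simp: independent_sets_grid_iff)
    moreover have "interval_partitionable 1 ({{}..{(1::nat, 1::nat)}} \<union> {{(1, 2)}..{(1, 2)}})"
      by (intro interval_partitionable_Un interval_partitionable_interval) auto
    ultimately show ?thesis using 2 by simp
  next
    case (3 m)
    let ?k = "(n + 2) div 3"
    let ?A = "\<lambda>c. {X. {(m + 1, c)} \<subseteq> X \<and> X - {(m + 1, c)} \<in> \<Delta> (m - 1)}"
    let ?B = "\<lambda>c::nat. {X. (if c = 1 then {} else {(m + 2, c)}) \<subseteq> X \<and> X - {(m + 2, c)} \<in> \<Delta> m}"
    have "interval_partitionable ?k (?A c)" for c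
    proof (rule interval_partitionable_mono)
      show "interval_partitionable (card {(m + 1, c)} + (m - 1 + 2) div 3) (?A c)"
        using 3 by (intro interval_partitionable_join less.IH disjoint_Union_independent) auto
      show "?k \<le> card {(m + 1, c)} + (m - 1 + 2) div 3"
        using 3 by (cases m) auto
    qed
    moreover have "interval_partitionable ?k (?B c)" for c
    proof (rule interval_partitionable_mono)
      show "interval_partitionable (card {(m + 2, c)} + (m + 2) div 3) (?B c)"
        using 3 by (intro interval_partitionable_join less.IH disjoint_Union_independent) auto
      show "?k \<le> card {(m + 2, c)} + (m + 2) div 3"
        using 3 by auto
    qed
    moreover have "disjoint_family_on ?A {1, 2}"
      using independent_bounds[of _ "m - 1"] by (fastforce simp: disjoint_family_on_def)
    moreover have "disjoint_family_on ?B {1, 2}"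
      using independent_bounds[of _ m] by (fastforce simp: disjoint_family_on_def)
    moreover have "(\<Union>c \<in> {1, 2}. ?A c) \<inter> (\<Union>c \<in> {1, 2}. ?B c) = {}"
    proof -
      have False if "X \<in> ?A c" "X \<in> ?B d" for X c d
        using independent_bounds[of "X - {(m + 2, d)}" m "(m + 1, c)"] that by auto
      then show ?thesis by blast
    qed
    ultimately show ?thesis unfolding 3 independent_sets_grid_rec
      by (intro interval_partitionable_Un interval_partitionable_UN) auto
  qed
qed

text \<open>If the part in the first \<open>n\<close> columns is independent, then some edge meets column \<open>n + 1\<close>: either
  both its vertices are present, or one vertex \<open>(n + 1, c)\<close> is joined to the vertex \<open>(n, d)\<close>, which
  by independence leaves only the first \<open>n - 2\<close> columns for the rest. For \<open>n = 0\<close> the last case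
  has to be excluded, as column \<open>0\<close> does not exist.\<close>
lemma dependent_sets_grid_rec:
  "dependent_sets (strong_grid (n + 1) 2) =
     {X. {} \<subseteq> X \<and> X - {n + 1} \<times> {1, 2} \<in> dependent_sets (strong_grid n 2)} \<union>
     {X. {n + 1} \<times> {1, 2} \<subseteq> X \<and> X - {n + 1} \<times> {1, 2} \<in> \<Delta> n} \<union>
     (\<Union>(c, d) \<in> {1, 2} \<times> (if n = 0 then {} else {1, 2}). {X. {(n + 1, c), (n, d)} \<subseteq> X \<and>
        X - {(n + 1, c), (n, d)} \<in> \<Delta> (n - 2)})"
  (is "?L = ?A \<union> ?B \<union> ?C")
proof (intro equalityI subsetI)
  fix X assume X: "X \<in> ?L"
  define Z where "Z = X - {n + 1} \<times> {1, 2}"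
  have V: "X \<subseteq> {1..n + 1} \<times> {1, 2}" using X by (simp only: dependent_sets_grid_iff)
  have Z_sub: "Z \<subseteq> {1..n} \<times> {1, 2}"
  proof
    fix q assume "q \<in> Z"
    then have "q \<in> X" "q \<notin> {n + 1} \<times> {1, 2}" unfolding Z_def Diff_iff by simp_all
    moreover have "q \<in> {1..n + 1} \<times> {1, 2}" using V \<open>q \<in> X\<close> by (rule subsetD)
    ultimately show "q \<in> {1..n} \<times> {1, 2}" by (cases q) auto
  qed
  show "X \<in> ?A \<union> ?B \<union> ?C"
  proof (cases "Z \<in> dependent_sets (strong_grid n 2) \<or> {n + 1} \<times> {1, 2} \<subseteq> X")
    case True
    then consider "Z \<in> dependent_sets (strong_grid n 2)" | "Z \<in> \<Delta> n" "{n + 1} \<times> {1, 2} \<subseteq> X"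
      using Z_sub by (auto simp: independent_sets_def pverts_strong_grid_2)
    then show ?thesis by cases (simp_all add: Z_def)
  next
    case False
    then have Z: "Z \<in> \<Delta> n" using Z_sub by (auto simp: independent_sets_def pverts_strong_grid_2)
    from X obtain p q where pq: "p \<in> X" "q \<in> X" "p \<noteq> q" "fst p \<le> fst q + 1" "fst q \<le> fst p + 1"
      unfolding dependent_sets_grid_iff by blast
    have not_both: "p \<notin> Z \<or> q \<notin> Z"
    proof (rule ccontr)
      assume "\<not> ?thesis"
      then have "fst p + 1 < fst q \<or> fst q + 1 < fst p"
        using Z pq(3) unfolding independent_sets_grid_iff by blast
      then show False using pq(4,5) by linarith
    qed
    have last: "r \<in> Z \<or> r = (n + 1, 1) \<or> r = (n + 1, 2)" if "r \<in> X" for r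
      using V that unfolding Z_def by (cases r) auto
    have "\<not> ((n + 1, 1) \<in> X \<and> (n + 1, 2) \<in> X)" using False by auto
    then have crossing: "\<exists>c. (n + 1, c) \<in> X \<and> c \<in> {1, 2} \<and> s \<in> Z \<and> n \<le> fst s"
      if "r \<in> X" "s \<in> X" "r \<noteq> s" "fst r \<le> fst s + 1" "r \<notin> Z" for r s
      using last[OF that(1)] last[OF that(2)] that by (elim disjE) auto
    have "\<exists>c r. (n + 1, c) \<in> X \<and> c \<in> {1, 2} \<and> r \<in> Z \<and> n \<le> fst r"
    proof (cases "p \<in> Z")
      case True
      then show ?thesis using crossing[OF pq(2,1) pq(3)[symmetric] pq(5)] not_both by blast
    next
      case False
      then show ?thesis using crossing[OF pq(1-4)] by blast
    qed
    then obtain c r where c: "(n + 1, c) \<in> X" "c \<in> {1, 2}" and r: "r \<in> Z" "n \<le> fst r"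
      by blast
    obtain d where d: "r = (n, d)" "d \<in> {1, 2}" "n \<noteq> 0"
      using Z_sub r by (cases r) auto
    have "r \<in> X" using r(1) by (simp add: Z_def)
    have "e = c" if "(n + 1, e) \<in> X" "e \<in> {1, 2}" for e
      using False c that by auto
    then have "X - {(n + 1, c), (n, d)} = Z - {(n, d)}"
      using c unfolding Z_def by blast
    moreover have "Z - {(n, d)} \<in> \<Delta> (n - 2)"
    proof (rule independent_remove[OF Z])
      show "(n, d) \<in> Z" using r(1) d(1) by simp
      show "fst q \<le> n + 1" if "q \<in> Z" for q
        using independent_bounds[OF Z that] by linarith
    qed
    ultimately have "{(n + 1, c), (n, d)} \<subseteq> X \<and> X - {(n + 1, c), (n, d)} \<in> \<Delta> (n - 2)"
      using c(1) \<open>r \<in> X\<close> d(1) by simp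
    then have "X \<in> ?C" using c(2) d(2,3) by (intro UN_I[of "(c, d)"]) auto
    then show ?thesis by blast
  qed
next
  fix X assume "X \<in> ?A \<union> ?B \<union> ?C"
  have sub: "X \<subseteq> {1..n + 1} \<times> {1, 2}"
    if "X - D \<subseteq> {1..k} \<times> {1, 2}" "D \<subseteq> {1..n + 1} \<times> {1, 2}" "k \<le> n" for D k
  proof -
    have "{1..k} \<times> {1, 2::nat} \<subseteq> {1..n + 1} \<times> {1, 2}" using that(3) by auto
    then show ?thesis using that(1,2) by blast
  qed
  from \<open>X \<in> ?A \<union> ?B \<union> ?C\<close>
  consider "X \<in> ?A" | "X \<in> ?B" | "X \<in> ?C" by blast
  then show "X \<in> ?L"
  proof cases
    case 1
    then obtain p q where "p \<in> X" "q \<in> X" "p \<noteq> q" "fst p \<le> fst q + 1" "fst q \<le> fst p + 1"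
      unfolding dependent_sets_grid_iff by blast
    moreover have "X \<subseteq> {1..n + 1} \<times> {1, 2}"
      by (rule sub[of "{n + 1} \<times> {1, 2}" n]) (use 1 in \<open>auto simp: dependent_sets_grid_iff\<close>)
    ultimately show ?thesis unfolding dependent_sets_grid_iff by blast
  next
    case 2
    then have "(n + 1, 1) \<in> X" "(n + 1, 2) \<in> X" by auto
    moreover have "X \<subseteq> {1..n + 1} \<times> {1, 2}"
      by (rule sub[of "{n + 1} \<times> {1, 2}" n]) (use 2 in \<open>auto simp: independent_sets_grid_iff\<close>)
    moreover have "(n + 1, 1::nat) \<noteq> (n + 1, 2)" by simp
    ultimately show ?thesis unfolding dependent_sets_grid_iff
      by (intro conjI bexI[of _ "(n + 1, 1)"] bexI[of _ "(n + 1, 2)"]) simp_all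
  next
    case 3
    then obtain c d where *: "c \<in> {1, 2}" "d \<in> {1, 2}" "n \<noteq> 0" "(n + 1, c) \<in> X" "(n, d) \<in> X"
      "X - {(n + 1, c), (n, d)} \<in> \<Delta> (n - 2)" by (auto split: if_splits)
    moreover have "X \<subseteq> {1..n + 1} \<times> {1, 2}"
      by (rule sub[of "{(n + 1, c), (n, d)}" "n - 2"]) (use * in \<open>auto simp: independent_sets_grid_iff\<close>)
    ultimately show ?thesis unfolding dependent_sets_grid_iff
      by (intro conjI bexI[of _ "(n + 1, c)"] bexI[of _ "(n, d)"]) simp_all
  qed
qed

text \<open>Two vertices are added in the cases with independent rest, against at most three columns
  removed, so the bound exceeds the one for independent sets by one. In the remaining case
  the last column is free and its two vertices more than compensate its removal.\<close>
lemma interval_partitionable_dependent_sets: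
  "interval_partitionable ((n + 2) div 3 + 1) (dependent_sets (strong_grid n 2))"
proof (induction n)
  case 0
  have "dependent_sets (strong_grid 0 2) = {}"
    by (auto simp: dependent_sets_def parcs_strong_grid_2)
  then show ?case by (simp add: interval_partitionable.empty)
next
  case (Suc n)
  let ?k = "(Suc n + 2) div 3 + 1"
  let ?A = "{X. {} \<subseteq> X \<and> X - {n + 1} \<times> {1, 2} \<in> dependent_sets (strong_grid n 2)}"
  let ?B = "{X. {n + 1} \<times> {1, 2} \<subseteq> X \<and> X - {n + 1} \<times> {1, 2} \<in> \<Delta> n}"
  let ?J = "{1, 2::nat} \<times> (if n = 0 then {} else {1, 2::nat})"
  let ?C = "\<lambda>(c, d). {X. {(n + 1, c), (n, d)} \<subseteq> X \<and> X - {(n + 1, c), (n, d)} \<in> \<Delta> (n - 2)}"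
  have "interval_partitionable ?k ?A"
  proof (rule interval_partitionable_mono)
    show "interval_partitionable (card ({n + 1} \<times> {1, 2::nat}) + ((n + 2) div 3 + 1)) ?A"
      by (intro interval_partitionable_join Suc.IH) (auto simp: dependent_sets_def pverts_strong_grid_2)
  qed auto
  moreover have "interval_partitionable ?k ?B"
  proof (rule interval_partitionable_mono)
    show "interval_partitionable (card ({n + 1} \<times> {1, 2::nat}) + (n + 2) div 3) ?B"
      by (intro interval_partitionable_join interval_partitionable_independent_sets
          disjoint_Union_independent) auto
  qed auto
  moreover have "interval_partitionable ?k (?C p)" if "p \<in> ?J" for p
  proof -
    obtain c d where p: "p = (c, d)" by (cases p)
    have "n \<noteq> 0" using that by (auto split: if_splits)
    have "interval_partitionable (card {(n + 1, c), (n, d)} + (n - 2 + 2) div 3)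
       {X. {(n + 1, c), (n, d)} \<subseteq> X \<and> X - {(n + 1, c), (n, d)} \<in> \<Delta> (n - 2)}"
      using \<open>n \<noteq> 0\<close> by (intro interval_partitionable_join interval_partitionable_independent_sets
          disjoint_Union_independent) auto
    moreover have "?k \<le> card {(n + 1, c), (n, d)} + (n - 2 + 2) div 3"
      by auto
    ultimately show ?thesis unfolding p by (auto intro: interval_partitionable_mono)
  qed
  moreover have "disjoint_family_on ?C ?J"
    unfolding disjoint_family_on_def
  proof (intro ballI impI)
    fix p p' assume p: "p \<in> ?J" "p' \<in> ?J" "p \<noteq> p'"
    obtain c d c' d' where cd: "p = (c, d)" "p' = (c', d')" by (cases p; cases p')
    have "n \<noteq> 0" using p(1) by (auto split: if_splits)
    have "c \<noteq> c' \<or> d \<noteq> d'" using p(3) cd by simp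
    have False if X: "X \<in> ?C (c, d)" "X \<in> ?C (c', d')" for X
    proof -
      have rest: "X - {(n + 1, c), (n, d)} \<in> \<Delta> (n - 2)" and mem: "(n + 1, c') \<in> X" "(n, d') \<in> X"
        using X by simp_all
      have "c' = c"
        by (rule ccontr) (use independent_bounds[OF rest, of "(n + 1, c')"] mem(1) in auto)
      moreover have "d' = d"
        by (rule ccontr) (use independent_bounds[OF rest, of "(n, d')"] mem(2) \<open>n \<noteq> 0\<close> in auto)
      ultimately show False using \<open>c \<noteq> c' \<or> d \<noteq> d'\<close> by simp
    qed
    then show "?C p \<inter> ?C p' = {}" unfolding cd by blast
  qed
  (* Sets of the third kind have independent rest but contain only one vertex of the last column. *)
  moreover have C: "\<not> {n + 1} \<times> {1, 2} \<subseteq> X \<and> X - {n + 1} \<times> {1, 2} \<in> \<Delta> n"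
    if "p \<in> ?J" "X \<in> ?C p" for p X
  proof -
    obtain c d where cd: "p = (c, d)" by (cases p)
    have "n \<noteq> 0" "c \<in> {1, 2}" "d \<in> {1, 2}" using that(1) cd by (auto split: if_splits)
    have mem: "(n + 1, c) \<in> X" "(n, d) \<in> X" and rest: "X - {(n + 1, c), (n, d)} \<in> \<Delta> (n - 2)"
      using that(2) cd by simp_all
    have only: "e = c" if "(n + 1, e) \<in> X" for e
      by (rule ccontr) (use independent_bounds[OF rest, of "(n + 1, e)"] that in auto)
    have eq: "X - {n + 1} \<times> {1, 2} - {(n, d)} = X - {(n + 1, c), (n, d)}"
    proof -
      have "q = (n + 1, c)" if "q \<in> X" "q \<in> {n + 1} \<times> {1, 2}" for q
      proof -
        obtain e where "q = (n + 1, e)" using \<open>q \<in> {n + 1} \<times> {1, 2}\<close> by blast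
        then show ?thesis using only[of e] \<open>q \<in> X\<close> by simp
      qed
      moreover have "(n + 1, c) \<in> {n + 1} \<times> {1, 2}"
        using \<open>c \<in> {1, 2}\<close> by simp
      ultimately show ?thesis by blast
    qed
    have "X - {n + 1} \<times> {1, 2} \<in> \<Delta> n"
    proof (rule independent_of_remove)
      show "X - {n + 1} \<times> {1, 2} - {(n, d)} \<in> \<Delta> (n - 2)" unfolding eq by (rule rest)
    qed (use \<open>n \<noteq> 0\<close> \<open>d \<in> {1, 2}\<close> in simp_all)
    moreover have "\<not> {n + 1} \<times> {1, 2} \<subseteq> X"
      using only[of 1] only[of 2] by auto
    ultimately show ?thesis by blast
  qed
  moreover have "?A \<inter> ?B = {}" by (auto simp: independent_sets_def)
  moreover have "(?A \<union> ?B) \<inter> (\<Union>p \<in> ?J. ?C p) = {}"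
  proof -
    have False if "X \<in> ?A \<union> ?B" "X \<in> ?C p" "p \<in> ?J" for X p
      using C[OF that(3,2)] that(1) by (auto simp: independent_sets_def)
    then show ?thesis by blast
  qed
  ultimately have "interval_partitionable ?k (?A \<union> ?B \<union> (\<Union>p \<in> ?J. ?C p))"
    by (intro interval_partitionable_Un interval_partitionable_UN) auto
  then show ?case using dependent_sets_grid_rec[of n] by simp
qed

section \<open>The Stanley depths for the grid with two rows\<close>

text \<open>A vertex in column \<open>i\<close> dominates columns \<open>i - 1\<close>, \<open>i\<close> and \<open>i + 1\<close>, so choosing \<open>i\<close> to be the last
  column but one (or the only column) leaves the problem for \<open>i - 2\<close> columns.\<close>
lemma ex_small_maximal_independent_set:
  "\<exists>T \<in> \<Delta> n. card T = (n + 2) div 3 \<and>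
     (\<forall>v \<in> pverts (strong_grid n 2) - T. insert v T \<in> dependent_sets (strong_grid n 2))"
proof (induction n rule: less_induct)
  case (less n)
  show ?case
  proof (cases "n = 0")
    case True
    then show ?thesis
      by (intro bexI[of _ "{}"]) (auto simp: independent_sets_grid_iff pverts_strong_grid_2)
  next
    case False
    define i where "i = max 1 (n - 1)"
    have "n = 1 \<or> n = 2 \<or> (\<exists>m. n = m + 3)" using False by presburger
    then have i: "i \<in> {1..n}" "n \<le> i + 1" "i - 2 < n" "1 + (i - 2 + 2) div 3 = (n + 2) div 3"
      by (auto simp: i_def)
    obtain T where T: "T \<in> \<Delta> (i - 2)" "card T = (i - 2 + 2) div 3"
      "\<And>v. v \<in> pverts (strong_grid (i - 2) 2) - T \<Longrightarrow> insert v T \<in> dependent_sets (strong_grid (i - 2) 2)"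
      using less.IH[OF i(3)] by blast
    have far: "fst q + 1 < i" if "q \<in> T" for q
      using independent_bounds[OF T(1) that] by linarith
    have "finite T"
      using T(1) unfolding independent_sets_grid_iff
      by (meson finite_SigmaI finite_atLeastAtMost finite.intros finite_subset)
    have T': "insert (i, 1) T \<in> \<Delta> n"
      using i far by (intro independent_insert[OF T(1)]) auto
    show ?thesis
    proof (intro bexI[OF _ T'] conjI ballI)
      show "card (insert (i, 1) T) = (n + 2) div 3"
        using far[of "(i, 1)"] \<open>finite T\<close> T(2) i(4) by (subst card_insert_disjoint) auto
      fix v assume v: "v \<in> pverts (strong_grid n 2) - insert (i, 1) T"
      have sub: "insert v (insert (i, 1) T) \<subseteq> {1..n} \<times> {1, 2}"
        using v T' unfolding independent_sets_grid_iff pverts_strong_grid_2 by blast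
      have "\<exists>p \<in> insert v (insert (i, 1) T). \<exists>q \<in> insert v (insert (i, 1) T).
        p \<noteq> q \<and> fst p \<le> fst q + 1 \<and> fst q \<le> fst p + 1"
      proof (cases "fst v \<le> i - 2")
        case True
        then have "v \<in> pverts (strong_grid (i - 2) 2) - T"
          using v unfolding pverts_strong_grid_2 by (cases v) auto
        then show ?thesis using T(3) unfolding dependent_sets_grid_iff by blast
      next
        case False
        then have "i \<le> fst v + 1" "fst v \<le> i + 1"
          using v i(2) unfolding pverts_strong_grid_2 by (cases v, auto)+
        then show ?thesis using v by (intro bexI[of _ v] bexI[of _ "(i, 1)"]) auto
      qed
      with sub show "insert v (insert (i, 1) T) \<in> dependent_sets (strong_grid n 2)"
        unfolding dependent_sets_grid_iff by blast
    qed
  qed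
qed

theorem theorem4p3:
  fixes n :: nat
  assumes "n \<ge> 1"
  shows
    "let V = pverts (strong_grid n 2);
         I = (edge_ideal (strong_grid n 2) :: (nat \<times> nat, 'k::field) mpol set)
     in sdepth V (ideal_module V I) > sdepth V (quotient_module V I) \<and>
        int (sdepth V (quotient_module V I)) = \<lceil>real n / 3\<rceil>"
proof -
  let ?G = "strong_grid n 2"
  let ?V = "pverts ?G" and ?I = "edge_ideal ?G :: (nat \<times> nat, 'k) mpol set"
  let ?F = "dependent_sets ?G"
  have G: "pair_graph ?G" by (intro pair_graph_strong_product pair_graph_path_graph)
  have ideal: "ideal ?I (poly_ring ?V)" by (rule ideal_edge_ideal[OF G])
  have span: "?I = monomial_span ?F" by (rule edge_ideal_eq_monomial_span[OF G])
  have fin: "finite ?V" by (simp add: pverts_strong_grid_2)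
  have indep: "Pow ?V - ?F = independent_sets ?G" by (simp add: independent_sets_def)
  obtain T where T: "T \<in> independent_sets ?G" "card T = (n + 2) div 3"
    "\<And>v. v \<in> ?V - T \<Longrightarrow> insert v T \<in> ?F"
    using ex_small_maximal_independent_set[of n] by blast
  have "T \<subseteq> ?V" "T \<notin> ?F" using T(1) by (auto simp: independent_sets_def)
  have "{(1, 1), (1, 2)} \<in> ?F"
    unfolding dependent_sets_grid_iff using assms by (auto simp: exI[of _ "1::nat"])
  then have "?F \<noteq> {}" by blast
  have "(n + 2) div 3 + 1 \<le> sdepth ?V (ideal_module ?V ?I)"
    by (rule sdepth_ideal_module_ge[OF fin _ \<open>?F \<noteq> {}\<close> ideal span interval_partitionable_dependent_sets])
      (auto simp: dependent_sets_def)
  moreover have "sdepth ?V (quotient_module ?V ?I) = (n + 2) div 3"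
    by (rule sdepth_quotient_module_eq[OF fin ideal span \<open>T \<subseteq> ?V\<close> \<open>T \<notin> ?F\<close> T(3) _ T(2)[symmetric]],
        assumption, unfold indep, rule interval_partitionable_independent_sets)
  moreover have "\<lceil>real n / 3\<rceil> = int ((n + 2) div 3)"
  proof -
    have "real n / 3 \<le> real ((n + 2) div 3)" "real ((n + 2) div 3) - 1 < real n / 3"
      by linarith+
    then show ?thesis by (intro ceiling_unique) auto
  qed
  ultimately show ?thesis unfolding Let_def by simp
qed

end
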